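(* Let $M$ be a smooth manifold of dimension $n$, let $\sigma\colon M\to\mathds{X}_{n+1}$ be an admissible immersion and let $g=\sigma^*\langle\cdot,\cdot\rangle$ be the induced complex metric. Let $\nabla$ be the Levi-Civita connection of $g$, $R^M$ the ($(0,4)$-type) curvature tensor of $g$, and $\Psi$ the shape operator of $\sigma$. Fix a (local) $g$-orthonormal frame $(X_i)_{i=1}^n$ of $\mathbb{C}TM$ with dual coframe $(\theta^i)_{i=1}^n$, and write $\Psi=\sum_i\Psi^i\otimes X_i$ with $\Psi^i$ 1-forms. Then: 1) $d^\nabla\Psi\equiv0$ (Codazzi equation); 2) $R^M(X_i,X_j,\cdot,\cdot)-\Psi^i\wedge\Psi^j=-\theta^i\wedge\theta^j$ for all $i,j$ (Gauss equation).
   Context: $\mathds{X}_{n+1}=\{z\in\mathbb{C}^{n+2}:\sum z_i^2=-1\}$ with the holomorphic Riemannian metric $\langle\cdot,\cdot\rangle$ restricted from the standard $\mathbb{C}$-bilinear form $\sum z_iw_i$ on $\mathbb{C}^{n+2}$; $D$ is its Levi-Civita connection. $\mathbb{C}TM=TM\otimes_{\mathbb R}\mathbb{C}$. A complex metric on $M$ is a smoothly varying non-degenerate symmetric $\mathbb{C}$-bilinear form $g_p$ on $\mathbb{C}T_pM$. Its Levi-Civita connection $\nabla$ is the unique torsion-free connection on $\mathbb{C}TM$ (with $\mathbb{C}$-linear derivatives along sections of $\mathbb{C}TM$) compatible with $g$; $R(X,Y)Z=\nabla_X\nabla_YZ-\nabla_Y\nabla_XZ-\nabla_{[X,Y]}Z$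 and $R^M(X,Y,Z,T)=-g(R(X,Y)Z,T)$. The differential of an immersion $\sigma\colon M\to\mathds{X}_{n+1}$ is extended $\mathbb{C}$-linearly to $\mathbb{C}TM$; $\sigma$ is admissible if $g(X,Y)=\langle\sigma_*X,\sigma_*Y\rangle$ is a complex metric. Then $\mathbb{C}TM$ is a subbundle of $\sigma^*T\mathds{X}_{n+1}$. A local normal field $\nu$ is a local section of $\sigma^*T\mathds{X}_{n+1}$ orthogonal to $\mathbb{C}TM$ with $\langle\nu,\nu\rangle=1$ (unique up to sign). With $\overline\nabla=\sigma^*D$ (extended $\mathbb{C}$-linearly), the shape operator $\Psi\colon\mathbb{C}TM\to\mathbb{C}TM$ is defined, up to sign, by $g(\Psi(X),Y)=-\langle\overline\nabla_XY,\nu\rangle$. $(d^\nabla\Psi)(X,Y)=\nabla_X(\Psi(Y))-\nabla_Y(\Psi(X))-\Psi([X,Y])$, and $(\alpha\wedge\beta)(X,Y)=\alpha(X)\beta(Y)-\alpha(Y)\beta(X)$ for 1-forms. *)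

theory Defs
  imports "HOL-Analysis.Analysis"
begin

section \<open>Smooth manifolds\<close>

primrec Ck_on :: "nat \<Rightarrow> 'a::euclidean_space set \<Rightarrow> ('a \<Rightarrow> 'b::real_normed_vector) \<Rightarrow> bool" where
  "Ck_on 0 = (\<lambda>S f. continuous_on S f)"
| "Ck_on (Suc k) = (\<lambda>S f. (\<forall>x\<in>S. f differentiable (at x)) \<and>
      (\<forall>v. Ck_on k S (\<lambda>x. frechet_derivative f (at x) v)))"

text \<open>Meaningful for open sets only.\<close>

definition Cinf_on :: "'a::euclidean_space set \<Rightarrow> ('a \<Rightarrow> 'b::real_normed_vector) \<Rightarrow> bool" where
  "Cinf_on S f \<longleftrightarrow> (\<forall>k. Ck_on k S f)"

text \<open>The manifold is the whole type \<open>'m\<close> and its dimension is \<open>CARD('n)\<close>; the Hausdorff property and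
  second countability come from the type classes imposed on \<open>'m\<close> below.\<close>

type_synonym ('m, 'n) atlas = "('m set \<times> ('m \<Rightarrow> real ^ 'n)) set"

definition smooth_manifold ::
    "('m::{t2_space, second_countable_topology}, 'n::finite) atlas \<Rightarrow> bool" where
  "smooth_manifold A \<longleftrightarrow>
     (\<Union>(U, \<phi>)\<in>A. U) = UNIV \<and>
     (\<forall>(U, \<phi>)\<in>A. open U \<and> open (\<phi> ` U) \<and> homeomorphism U (\<phi> ` U) \<phi> (inv_into U \<phi>)) \<and>
     (\<forall>(U, \<phi>)\<in>A. \<forall>(V, \<psi>)\<in>A. Cinf_on (\<phi> ` (U \<inter> V)) (\<psi> \<circ> inv_into U \<phi>))"

definition smooth_map_on ::
    "('m::topological_space, 'n::finite) atlas \<Rightarrow> 'm set \<Rightarrow> ('m \<Rightarrow> 'b::real_normed_vector) \<Rightarrow> bool" where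
  "smooth_map_on A S f \<longleftrightarrow> (\<forall>(U, \<phi>)\<in>A. Cinf_on (\<phi> ` (S \<inter> U)) (f \<circ> inv_into U \<phi>))"

definition smooth_near ::
    "('m::topological_space, 'n::finite) atlas \<Rightarrow> 'm \<Rightarrow> ('m \<Rightarrow> 'b::real_normed_vector) \<Rightarrow> bool" where
  "smooth_near A p f \<longleftrightarrow> (\<exists>S. open S \<and> p \<in> S \<and> smooth_map_on A S f)"

section \<open>Tangent spaces and their complexification\<close>

text \<open>Tangent vectors at \<open>p\<close> are the derivations of the algebra of germs at \<open>p\<close> of real smooth
  functions. They are modelled on total functions; on functions that are not smooth near \<open>p\<close> the
  value is normalised to \<open>0\<close>, so that equality of vectors is equality of derivations of germs.\<close>

definition tangent_space ::
    "('m::topological_space, 'n::finite) atlas \<Rightarrow> 'm \<Rightarrow> (('m \<Rightarrow> real) \<Rightarrow> real) set" where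
  "tangent_space A p = {v.
     (\<forall>f h. smooth_near A p f \<longrightarrow> smooth_near A p h \<longrightarrow>
        v (\<lambda>q. f q + h q) = v f + v h \<and>
        v (\<lambda>q. f q * h q) = f p * v h + h p * v f) \<and>
     (\<forall>c f. smooth_near A p f \<longrightarrow> v (\<lambda>q. c * f q) = c * v f) \<and>
     (\<forall>f h. smooth_near A p f \<longrightarrow> smooth_near A p h \<longrightarrow>
        (\<forall>\<^sub>F q in nhds p. f q = h q) \<longrightarrow> v f = v h) \<and>
     (\<forall>f. \<not> smooth_near A p f \<longrightarrow> v f = 0)}"

text \<open>A vector \<open>u \<otimes> 1 + v \<otimes> \<i>\<close> of \<open>T\<^sub>pM \<otimes>\<^sub>\<real> \<complex>\<close>, with \<open>u\<close> and \<open>v\<close> real tangent vectors, is represented by the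
  complex-valued functional \<open>f \<mapsto> u f + \<i> v f\<close> on real functions.\<close>

type_synonym 'm ctvec = "('m \<Rightarrow> real) \<Rightarrow> complex"
type_synonym 'm cvfield = "'m \<Rightarrow> 'm ctvec"

definition ctangent_space ::
    "('m::topological_space, 'n::finite) atlas \<Rightarrow> 'm \<Rightarrow> 'm ctvec set" where
  "ctangent_space A p =
     {w. (\<lambda>f. Re (w f)) \<in> tangent_space A p \<and> (\<lambda>f. Im (w f)) \<in> tangent_space A p}"

definition complexify :: "(('m \<Rightarrow> real) \<Rightarrow> real) \<Rightarrow> 'm ctvec" where
  "complexify v = (\<lambda>f. complex_of_real (v f))"

text \<open>The \<open>\<complex>\<close>-linear derivative of a complex function along a complex tangent vector.\<close>

definition cderiv :: "'m ctvec \<Rightarrow> ('m \<Rightarrow> complex) \<Rightarrow> complex" where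
  "cderiv v f = v (\<lambda>q. Re (f q)) + \<i> * v (\<lambda>q. Im (f q))"

definition cvderiv :: "'m ctvec \<Rightarrow> ('m \<Rightarrow> complex ^ 'k) \<Rightarrow> complex ^ 'k" where
  "cvderiv v f = (\<chi> k. cderiv v (\<lambda>q. f q $ k))"

definition vector_field_on ::
    "('m::topological_space, 'n::finite) atlas \<Rightarrow> 'm set \<Rightarrow> 'm cvfield \<Rightarrow> bool" where
  "vector_field_on A S X \<longleftrightarrow>
     (\<forall>p\<in>S. X p \<in> ctangent_space A p) \<and>
     (\<forall>V (f :: 'm \<Rightarrow> real). open V \<longrightarrow> V \<subseteq> S \<longrightarrow> smooth_map_on A V f \<longrightarrow>
        smooth_map_on A V (\<lambda>p. X p f))"

definition vector_field_near ::
    "('m::topological_space, 'n::finite) atlas \<Rightarrow> 'm \<Rightarrow> 'm cvfield \<Rightarrow> bool" where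
  "vector_field_near A p X \<longleftrightarrow> (\<exists>S. open S \<and> p \<in> S \<and> vector_field_on A S X)"

definition lie_bracket ::
    "('m::topological_space, 'n::finite) atlas \<Rightarrow> 'm cvfield \<Rightarrow> 'm cvfield \<Rightarrow> 'm cvfield" where
  "lie_bracket A X Y p = (\<lambda>f.
     if smooth_near A p f then cderiv (X p) (\<lambda>q. Y q f) - cderiv (Y p) (\<lambda>q. X q f) else 0)"

section \<open>Complex metrics, Levi-Civita connection, curvature\<close>

type_synonym 'm cmetric = "'m \<Rightarrow> 'm ctvec \<Rightarrow> 'm ctvec \<Rightarrow> complex"

definition complex_metric ::
    "('m::topological_space, 'n::finite) atlas \<Rightarrow> 'm cmetric \<Rightarrow> bool" where
  "complex_metric A g \<longleftrightarrow>
     (\<forall>p. \<forall>u\<in>ctangent_space A p. \<forall>v\<in>ctangent_space A p. \<forall>w\<in>ctangent_space A p. \<forall>a b.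
        g p (\<lambda>f. a * u f + b * v f) w = a * g p u w + b * g p v w) \<and>
     (\<forall>p. \<forall>u\<in>ctangent_space A p. \<forall>v\<in>ctangent_space A p. g p u v = g p v u) \<and>
     (\<forall>p. \<forall>u\<in>ctangent_space A p. (\<forall>v\<in>ctangent_space A p. g p u v = 0) \<longrightarrow> u = (\<lambda>_. 0)) \<and>
     (\<forall>S X Y. open S \<longrightarrow> vector_field_on A S X \<longrightarrow> vector_field_on A S Y \<longrightarrow>
        smooth_map_on A S (\<lambda>p. g p (X p) (Y p)))"

text \<open>A connection \<open>N\<close> on the complexified tangent bundle, acting on local sections:
  \<open>N p v Y\<close> is the derivative at \<open>p\<close>, along \<open>v\<close>, of a section \<open>Y\<close> defined near \<open>p\<close>.\<close>

type_synonym 'm connection = "'m \<Rightarrow> 'm ctvec \<Rightarrow> 'm cvfield \<Rightarrow> 'm ctvec"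

definition is_connection ::
    "('m::topological_space, 'n::finite) atlas \<Rightarrow> 'm connection \<Rightarrow> bool" where
  "is_connection A N \<longleftrightarrow>
     (\<forall>p Y. vector_field_near A p Y \<longrightarrow>
        (\<forall>v\<in>ctangent_space A p. N p v Y \<in> ctangent_space A p) \<and>
        (\<forall>u\<in>ctangent_space A p. \<forall>v\<in>ctangent_space A p. \<forall>a b.
           N p (\<lambda>f. a * u f + b * v f) Y = (\<lambda>f. a * N p u Y f + b * N p v Y f))) \<and>
     (\<forall>p Y Z. vector_field_near A p Y \<longrightarrow> vector_field_near A p Z \<longrightarrow>
        (\<forall>v\<in>ctangent_space A p.
           N p v (\<lambda>q f. Y q f + Z q f) = (\<lambda>f. N p v Y f + N p v Z f) \<and>
           ((\<forall>\<^sub>F q in nhds p. Y q = Z q) \<longrightarrow> N p v Y = N p v Z))) \<and>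
     (\<forall>p Y (h :: 'm \<Rightarrow> complex). vector_field_near A p Y \<longrightarrow> smooth_near A p h \<longrightarrow>
        (\<forall>v\<in>ctangent_space A p.
           N p v (\<lambda>q f. h q * Y q f) = (\<lambda>f. cderiv v h * Y p f + h p * N p v Y f))) \<and>
     (\<forall>S X Y. open S \<longrightarrow> vector_field_on A S X \<longrightarrow> vector_field_on A S Y \<longrightarrow>
        vector_field_on A S (\<lambda>p. N p (X p) Y))"

definition levi_civita ::
    "('m::topological_space, 'n::finite) atlas \<Rightarrow> 'm cmetric \<Rightarrow> 'm connection \<Rightarrow> bool" where
  "levi_civita A g N \<longleftrightarrow> is_connection A N \<and>
     (\<forall>p X Y. vector_field_near A p X \<longrightarrow> vector_field_near A p Y \<longrightarrow>
        (\<lambda>f. N p (X p) Y f - N p (Y p) X f) = lie_bracket A X Y p) \<and>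
     (\<forall>p X Y. vector_field_near A p X \<longrightarrow> vector_field_near A p Y \<longrightarrow>
        (\<forall>v\<in>ctangent_space A p.
           cderiv v (\<lambda>q. g q (X q) (Y q)) = g p (N p v X) (Y p) + g p (X p) (N p v Y)))"

definition curvature ::
    "('m::topological_space, 'n::finite) atlas \<Rightarrow> 'm connection \<Rightarrow>
     'm cvfield \<Rightarrow> 'm cvfield \<Rightarrow> 'm cvfield \<Rightarrow> 'm cvfield" where
  "curvature A N X Y Z p = (\<lambda>f.
     N p (X p) (\<lambda>q. N q (Y q) Z) f - N p (Y p) (\<lambda>q. N q (X q) Z) f
     - N p (lie_bracket A X Y p) Z f)"

definition curvature4 ::
    "('m::topological_space, 'n::finite) atlas \<Rightarrow> 'm cmetric \<Rightarrow> 'm connection \<Rightarrow>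
     'm cvfield \<Rightarrow> 'm cvfield \<Rightarrow> 'm cvfield \<Rightarrow> 'm cvfield \<Rightarrow> 'm \<Rightarrow> complex" where
  "curvature4 A g N X Y Z T p = - g p (curvature A N X Y Z p) (T p)"

section \<open>The quadric\<close>

definition cbilin :: "complex ^ 'k \<Rightarrow> complex ^ 'k \<Rightarrow> complex" where
  "cbilin z w = (\<Sum>i\<in>UNIV. z $ i * w $ i)"

definition quadric :: "(complex ^ 'k) set" where
  "quadric = {z. cbilin z z = - 1}"

definition quadric_tangent :: "complex ^ 'k \<Rightarrow> (complex ^ 'k) set" where
  "quadric_tangent z = {w. cbilin z w = 0}"

text \<open>Local smooth vector fields on the embedded submanifold \<open>quadric\<close> are represented by smooth
  local extensions to the ambient space; connections must not depend on the extension.\<close>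

definition quadric_field_near :: "complex ^ 'k \<Rightarrow> (complex ^ 'k \<Rightarrow> complex ^ 'k) \<Rightarrow> bool" where
  "quadric_field_near z Y \<longleftrightarrow> (\<exists>S. open S \<and> z \<in> S \<and> Cinf_on S Y \<and>
     (\<forall>w\<in>S \<inter> quadric. Y w \<in> quadric_tangent w))"

type_synonym 'k qconnection =
  "complex ^ 'k \<Rightarrow> complex ^ 'k \<Rightarrow> (complex ^ 'k \<Rightarrow> complex ^ 'k) \<Rightarrow> complex ^ 'k"

definition quadric_connection :: "'k::finite qconnection \<Rightarrow> bool" where
  "quadric_connection D \<longleftrightarrow>
     (\<forall>z\<in>quadric. \<forall>Y. quadric_field_near z Y \<longrightarrow>
        (\<forall>v\<in>quadric_tangent z. D z v Y \<in> quadric_tangent z) \<and>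
        (\<forall>u\<in>quadric_tangent z. \<forall>v\<in>quadric_tangent z. \<forall>a b :: real.
           D z (a *\<^sub>R u + b *\<^sub>R v) Y = a *\<^sub>R D z u Y + b *\<^sub>R D z v Y)) \<and>
     (\<forall>z\<in>quadric. \<forall>Y Z. quadric_field_near z Y \<longrightarrow> quadric_field_near z Z \<longrightarrow>
        (\<forall>v\<in>quadric_tangent z.
           D z v (\<lambda>w. Y w + Z w) = D z v Y + D z v Z \<and>
           ((\<forall>\<^sub>F w in nhds z. w \<in> quadric \<longrightarrow> Y w = Z w) \<longrightarrow> D z v Y = D z v Z))) \<and>
     (\<forall>z\<in>quadric. \<forall>Y (h :: complex ^ 'k \<Rightarrow> real) S. quadric_field_near z Y \<longrightarrow>
        open S \<longrightarrow> z \<in> S \<longrightarrow> Cinf_on S h \<longrightarrow>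
        (\<forall>v\<in>quadric_tangent z.
           D z v (\<lambda>w. h w *\<^sub>R Y w) = frechet_derivative h (at z) v *\<^sub>R Y z + h z *\<^sub>R D z v Y)) \<and>
     (\<forall>z\<in>quadric. \<forall>X Y. quadric_field_near z X \<longrightarrow> quadric_field_near z Y \<longrightarrow>
        (\<exists>Z. quadric_field_near z Z \<and>
           (\<forall>\<^sub>F w in nhds z. w \<in> quadric \<longrightarrow> Z w = D w (X w) Y)))"

text \<open>Derivatives of extensions in directions tangent to the quadric, and hence also the bracket
  below, depend only on the restrictions to the quadric.\<close>

definition quadric_levi_civita :: "'k::finite qconnection \<Rightarrow> bool" where
  "quadric_levi_civita D \<longleftrightarrow> quadric_connection D \<and>
     (\<forall>z\<in>quadric. \<forall>X Y. quadric_field_near z X \<longrightarrow> quadric_field_near z Y \<longrightarrow>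
        D z (X z) Y - D z (Y z) X =
          frechet_derivative Y (at z) (X z) - frechet_derivative X (at z) (Y z)) \<and>
     (\<forall>z\<in>quadric. \<forall>X Y. quadric_field_near z X \<longrightarrow> quadric_field_near z Y \<longrightarrow>
        (\<forall>v\<in>quadric_tangent z.
           frechet_derivative (\<lambda>w. cbilin (X w) (Y w)) (at z) v =
             cbilin (D z v X) (Y z) + cbilin (X z) (D z v Y)))"

section \<open>Immersions into the quadric\<close>

text \<open>\<open>cvderiv v \<sigma>\<close> is the \<open>\<complex>\<close>-linearly extended differential of \<open>\<sigma>\<close>, applied to \<open>v\<close>. Since
  the quadric is an embedded submanifold, smoothness is smoothness into the ambient space.\<close>

definition immersion ::
    "('m::topological_space, 'n::finite) atlas \<Rightarrow> ('m \<Rightarrow> complex ^ 'k::finite) \<Rightarrow> bool" where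
  "immersion A \<sigma> \<longleftrightarrow> smooth_map_on A UNIV \<sigma> \<and> (\<forall>p. \<sigma> p \<in> quadric) \<and>
     (\<forall>p. \<forall>v\<in>tangent_space A p. cvderiv (complexify v) \<sigma> = 0 \<longrightarrow> v = (\<lambda>_. 0))"

definition induced_metric :: "('m \<Rightarrow> complex ^ 'k::finite) \<Rightarrow> 'm cmetric" where
  "induced_metric \<sigma> p u v = cbilin (cvderiv u \<sigma>) (cvderiv v \<sigma>)"

definition admissible_immersion ::
    "('m::topological_space, 'n::finite) atlas \<Rightarrow> ('m \<Rightarrow> complex ^ 'k::finite) \<Rightarrow> bool" where
  "admissible_immersion A \<sigma> \<longleftrightarrow> immersion A \<sigma> \<and> complex_metric A (induced_metric \<sigma>)"

definition pullback_section_on ::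
    "('m::topological_space, 'n::finite) atlas \<Rightarrow> ('m \<Rightarrow> complex ^ 'k::finite) \<Rightarrow> 'm set \<Rightarrow>
     ('m \<Rightarrow> complex ^ 'k) \<Rightarrow> bool" where
  "pullback_section_on A \<sigma> S W \<longleftrightarrow>
     smooth_map_on A S W \<and> (\<forall>p\<in>S. W p \<in> quadric_tangent (\<sigma> p))"

definition pullback_section_near ::
    "('m::topological_space, 'n::finite) atlas \<Rightarrow> ('m \<Rightarrow> complex ^ 'k::finite) \<Rightarrow> 'm \<Rightarrow>
     ('m \<Rightarrow> complex ^ 'k) \<Rightarrow> bool" where
  "pullback_section_near A \<sigma> p W \<longleftrightarrow> (\<exists>S. open S \<and> p \<in> S \<and> pullback_section_on A \<sigma> S W)"

type_synonym ('m, 'k) pconnection =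
  "'m \<Rightarrow> 'm ctvec \<Rightarrow> ('m \<Rightarrow> complex ^ 'k) \<Rightarrow> complex ^ 'k"

text \<open>\<open>B\<close> is the pullback of \<open>D\<close> by \<open>\<sigma>\<close>, extended \<open>\<complex>\<close>-linearly to complex tangent vectors:
  a connection determined by its values on sections of the form \<open>Y \<circ> \<sigma>\<close> (last clause).\<close>

definition pullback_connection ::
    "('m::topological_space, 'n::finite) atlas \<Rightarrow> ('m \<Rightarrow> complex ^ 'k::finite) \<Rightarrow>
     'k qconnection \<Rightarrow> ('m, 'k) pconnection \<Rightarrow> bool" where
  "pullback_connection A \<sigma> D B \<longleftrightarrow>
     (\<forall>p W. pullback_section_near A \<sigma> p W \<longrightarrow>
        (\<forall>v\<in>ctangent_space A p. B p v W \<in> quadric_tangent (\<sigma> p)) \<and>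
        (\<forall>u\<in>ctangent_space A p. \<forall>v\<in>ctangent_space A p. \<forall>a b.
           B p (\<lambda>f. a * u f + b * v f) W = a *s B p u W + b *s B p v W)) \<and>
     (\<forall>p W Z. pullback_section_near A \<sigma> p W \<longrightarrow> pullback_section_near A \<sigma> p Z \<longrightarrow>
        (\<forall>v\<in>ctangent_space A p.
           B p v (\<lambda>q. W q + Z q) = B p v W + B p v Z \<and>
           ((\<forall>\<^sub>F q in nhds p. W q = Z q) \<longrightarrow> B p v W = B p v Z))) \<and>
     (\<forall>p W (h :: 'm \<Rightarrow> real). pullback_section_near A \<sigma> p W \<longrightarrow> smooth_near A p h \<longrightarrow>
        (\<forall>v\<in>ctangent_space A p.
           B p v (\<lambda>q. h q *\<^sub>R W q) = v h *s W p + h p *\<^sub>R B p v W)) \<and>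
     (\<forall>S X W. open S \<longrightarrow> vector_field_on A S X \<longrightarrow> pullback_section_on A \<sigma> S W \<longrightarrow>
        pullback_section_on A \<sigma> S (\<lambda>p. B p (X p) W)) \<and>
     (\<forall>p Y. quadric_field_near (\<sigma> p) Y \<longrightarrow>
        (\<forall>v\<in>tangent_space A p.
           B p (complexify v) (\<lambda>q. Y (\<sigma> q)) = D (\<sigma> p) (cvderiv (complexify v) \<sigma>) Y))"

definition normal_field_on ::
    "('m::topological_space, 'n::finite) atlas \<Rightarrow> ('m \<Rightarrow> complex ^ 'k::finite) \<Rightarrow> 'm set \<Rightarrow>
     ('m \<Rightarrow> complex ^ 'k) \<Rightarrow> bool" where
  "normal_field_on A \<sigma> S \<nu> \<longleftrightarrow> pullback_section_on A \<sigma> S \<nu> \<and>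
     (\<forall>p\<in>S. cbilin (\<nu> p) (\<nu> p) = 1 \<and>
        (\<forall>v\<in>ctangent_space A p. cbilin (cvderiv v \<sigma>) (\<nu> p) = 0))"

definition endomorphism_on ::
    "('m::topological_space, 'n::finite) atlas \<Rightarrow> 'm set \<Rightarrow> ('m \<Rightarrow> 'm ctvec \<Rightarrow> 'm ctvec) \<Rightarrow> bool" where
  "endomorphism_on A S \<Psi> \<longleftrightarrow>
     (\<forall>p\<in>S. \<forall>v\<in>ctangent_space A p. \<Psi> p v \<in> ctangent_space A p) \<and>
     (\<forall>p\<in>S. \<forall>u\<in>ctangent_space A p. \<forall>v\<in>ctangent_space A p. \<forall>a b.
        \<Psi> p (\<lambda>f. a * u f + b * v f) = (\<lambda>f. a * \<Psi> p u f + b * \<Psi> p v f)) \<and>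
     (\<forall>V X. open V \<longrightarrow> V \<subseteq> S \<longrightarrow> vector_field_on A V X \<longrightarrow> vector_field_on A V (\<lambda>p. \<Psi> p (X p)))"

definition shape_operator_on ::
    "('m::topological_space, 'n::finite) atlas \<Rightarrow> ('m \<Rightarrow> complex ^ 'k::finite) \<Rightarrow>
     ('m, 'k) pconnection \<Rightarrow> ('m \<Rightarrow> complex ^ 'k) \<Rightarrow> 'm set \<Rightarrow> ('m \<Rightarrow> 'm ctvec \<Rightarrow> 'm ctvec) \<Rightarrow> bool"
  where
  "shape_operator_on A \<sigma> B \<nu> S \<Psi> \<longleftrightarrow> endomorphism_on A S \<Psi> \<and>
     (\<forall>p\<in>S. \<forall>v\<in>ctangent_space A p. \<forall>Y. vector_field_near A p Y \<longrightarrow>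
        induced_metric \<sigma> p (\<Psi> p v) (Y p) =
          - cbilin (B p v (\<lambda>q. cvderiv (Y q) \<sigma>)) (\<nu> p))"

definition d_nabla ::
    "('m::topological_space, 'n::finite) atlas \<Rightarrow> 'm connection \<Rightarrow> ('m \<Rightarrow> 'm ctvec \<Rightarrow> 'm ctvec) \<Rightarrow>
     'm cvfield \<Rightarrow> 'm cvfield \<Rightarrow> 'm cvfield" where
  "d_nabla A N \<Psi> X Y p = (\<lambda>f.
     N p (X p) (\<lambda>q. \<Psi> q (Y q)) f - N p (Y p) (\<lambda>q. \<Psi> q (X q)) f - \<Psi> p (lie_bracket A X Y p) f)"

section \<open>Frames and forms\<close>

definition orthonormal_frame_on ::
    "('m::topological_space, 'n::finite) atlas \<Rightarrow> 'm cmetric \<Rightarrow> 'm set \<Rightarrow> ('n \<Rightarrow> 'm cvfield) \<Rightarrow> bool"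
  where
  "orthonormal_frame_on A g S X \<longleftrightarrow>
     (\<forall>i. vector_field_on A S (X i)) \<and>
     (\<forall>p\<in>S. \<forall>v\<in>ctangent_space A p. \<exists>!c :: 'n \<Rightarrow> complex. v = (\<lambda>f. \<Sum>i\<in>UNIV. c i * X i p f)) \<and>
     (\<forall>p\<in>S. \<forall>i j. g p (X i p) (X j p) = (if i = j then 1 else 0))"

type_synonym 'm cform = "'m \<Rightarrow> 'm ctvec \<Rightarrow> complex"

definition one_form_on ::
    "('m::topological_space, 'n::finite) atlas \<Rightarrow> 'm set \<Rightarrow> 'm cform \<Rightarrow> bool" where
  "one_form_on A S \<alpha> \<longleftrightarrow>
     (\<forall>p\<in>S. \<forall>u\<in>ctangent_space A p. \<forall>v\<in>ctangent_space A p. \<forall>a b.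
        \<alpha> p (\<lambda>f. a * u f + b * v f) = a * \<alpha> p u + b * \<alpha> p v) \<and>
     (\<forall>V X. open V \<longrightarrow> V \<subseteq> S \<longrightarrow> vector_field_on A V X \<longrightarrow> smooth_map_on A V (\<lambda>p. \<alpha> p (X p)))"

definition dual_coframe_on ::
    "('m::topological_space, 'n::finite) atlas \<Rightarrow> 'm set \<Rightarrow> ('n \<Rightarrow> 'm cvfield) \<Rightarrow> ('n \<Rightarrow> 'm cform) \<Rightarrow> bool"
  where
  "dual_coframe_on A S X \<theta> \<longleftrightarrow> (\<forall>i. one_form_on A S (\<theta> i)) \<and>
     (\<forall>p\<in>S. \<forall>i j. \<theta> i p (X j p) = (if i = j then 1 else 0))"

definition wedge :: "'m cform \<Rightarrow> 'm cform \<Rightarrow> 'm cvfield \<Rightarrow> 'm cvfield \<Rightarrow> 'm \<Rightarrow> complex" where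
  "wedge \<alpha> \<beta> X Y p = \<alpha> p (X p) * \<beta> p (Y p) - \<alpha> p (Y p) * \<beta> p (X p)"

end

theory Submission
  imports Defs
begin

text \<open>
  The proof moves every intrinsic object into the flat space \<open>\<complex>\<^sup>k\<close> containing the quadric. To a complex
  vector field \<open>Y\<close> corresponds the vector function \<open>push Y = \<sigma>\<^sub>*Y\<close> with values in \<open>\<complex>\<^sup>k\<close>. For any smooth vector
  function \<open>F\<close> the commutator \<open>X(Y F) - Y(X F)\<close> equals \<open>[X,Y] F\<close>
  (\<open>cvderiv_lie_bracket\<close>): flat space has no torsion and no curvature. Both equations come from applying
  this one identity to \<open>F = \<nu>\<close> (Codazzi) and to \<open>F = push Z\<close> (Gauss), after the connections have been
  expressed by flat derivatives.

  Write \<open>\<langle>,\<rangle>\<close> for \<open>cbilin\<close>. The expressions needed are the following.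

  \<^item> \<open>B\<^sub>v W = dW(v) + \<langle>dW(v),\<sigma>\<rangle>\<sigma>\<close>, the projection of the flat derivative to the tangent space of the quadric
    (\<open>B_eq\<close>). The connection \<open>D\<close> is only evaluated on the fields \<open>w \<mapsto> u + \<langle>u,w\<rangle>w\<close>, where Koszul's argument
    determines it (\<open>quadric_levi_civita_proj_field\<close>); these fields span, so that \<open>B\<close> is determined too.

  \<^item> \<open>\<sigma>\<^sub>*(\<nabla>\<^sub>v Y) = d(push Y)(v) - g(v,Y)\<sigma> + g(\<Psi> v,Y)\<nu>\<close> and \<open>\<sigma>\<^sub>*(\<Psi> v) = d\<nu>(v)\<close>
    (\<open>gauss_formula\<close> and \<open>push_Psi\<close>). Along tangent directions the first one is again Koszul's argument, and
    the components along \<open>\<sigma>\<close> and \<open>\<nu>\<close> come from differentiating the constant products \<open>\<langle>push Y,\<sigma>\<rangle>\<close>,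
    \<open>\<langle>push Y,\<nu>\<rangle>\<close>, \<open>\<langle>\<nu>,\<sigma>\<rangle>\<close> and \<open>\<langle>\<nu>,\<nu>\<rangle>\<close>. Checking these components suffices because the image of
    \<open>\<complex>T\<^sub>pM\<close>, \<open>\<sigma> p\<close> and \<open>\<nu> p\<close> together span \<open>\<complex>\<^sup>k\<close>: this is where \<open>k = n + 2\<close> enters
    (\<open>orthogonal_to_frame_imp_zero\<close>).

  Koszul's argument and the definition of \<open>\<Psi>\<close> speak of vector fields, while the conclusions are pointwise.
  They are linked by the classical fact that every derivation of germs at a point is a coordinate vector
  (\<open>tangent_eq_chart_vector\<close>, by Hadamard's lemma), hence extends to a smooth field nearby
  (\<open>ctangent_extend\<close>).
\<close>

section \<open>Calculus of smooth functions on open sets\<close>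

lemma frechet_derivative_eqI:
  "(f has_derivative D) (at x) \<Longrightarrow> frechet_derivative f (at x) = D"
  by (metis frechet_derivative_at)

lemma differentiable_cong_open:
  assumes "open S" "x \<in> S" "\<And>y. y \<in> S \<Longrightarrow> f y = g y" "f differentiable (at x)"
  shows "g differentiable (at x)"
  using assms has_derivative_transform_within_open[of f _ x UNIV S g]
  unfolding differentiable_def by auto

lemma frechet_derivative_cong_open:
  assumes "open S" "x \<in> S" "\<And>y. y \<in> S \<Longrightarrow> f y = g y"
  shows "frechet_derivative f (at x) = frechet_derivative g (at x)"
proof -
  have "(f has_derivative D) (at x) \<longleftrightarrow> (g has_derivative D) (at x)" for D
    using assms has_derivative_transform_within_open[of f _ x UNIV S g]
      has_derivative_transform_within_open[of g _ x UNIV S f] by auto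
  then show ?thesis unfolding frechet_derivative_def by simp
qed

lemma Ck_on_cong:
  assumes "open S" "\<And>y. y \<in> S \<Longrightarrow> f y = g y" "Ck_on k S f"
  shows "Ck_on k S g"
  using assms(2,3)
proof (induction k arbitrary: f g)
  case 0
  then show ?case by (auto cong: continuous_on_cong)
next
  case (Suc k)
  have "g differentiable at x" if "x \<in> S" for x
    using Suc.prems differentiable_cong_open[OF assms(1) that, of f g] that by auto
  moreover have "Ck_on k S (\<lambda>x. frechet_derivative g (at x) v)" for v
  proof (rule Suc.IH[of "\<lambda>x. frechet_derivative f (at x) v"])
    show "Ck_on k S (\<lambda>x. frechet_derivative f (at x) v)" using Suc.prems by auto
    show "frechet_derivative f (at y) v = frechet_derivative g (at y) v" if "y \<in> S" for y
      by (simp add: frechet_derivative_cong_open[OF assms(1) that Suc.prems(1)])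
  qed
  ultimately show ?case by simp
qed

text \<open>Inductions on the order of smoothness exhibit a derivative \<open>D\<close> by a differentiation rule instead of
  computing \<open>frechet_derivative\<close>. Openness is what lets \<open>D\<close> replace it on \<open>S\<close>.\<close>

lemma Ck_on_SucI:
  assumes "open S" "\<And>x. x \<in> S \<Longrightarrow> (f has_derivative D x) (at x)"
    "\<And>v. Ck_on k S (\<lambda>x. D x v)"
  shows "Ck_on (Suc k) S f"
proof -
  have "Ck_on k S (\<lambda>x. frechet_derivative f (at x) v)" for v
    by (rule Ck_on_cong[OF assms(1) _ assms(3)]) (simp add: frechet_derivative_eqI[OF assms(2)])
  then show ?thesis using assms(2) by (auto simp: differentiable_def)
qed

lemma Ck_on_SucD:
  assumes "Ck_on (Suc k) S f"
  shows "x \<in> S \<Longrightarrow> (f has_derivative frechet_derivative f (at x)) (at x)"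
    and "Ck_on k S (\<lambda>x. frechet_derivative f (at x) v)"
  using assms by (auto simp: frechet_derivative_works)

lemma Ck_on_imp_continuous_on:
  "Ck_on k S f \<Longrightarrow> continuous_on S f"
  by (cases k) (auto intro!: continuous_at_imp_continuous_on differentiable_imp_continuous_within)

lemma Ck_on_Suc_imp: "Ck_on (Suc k) S f \<Longrightarrow> Ck_on k S f"
proof (induction k arbitrary: f)
  case 0
  then show ?case using Ck_on_imp_continuous_on[OF 0] by simp
next
  case (Suc k)
  then show ?case by (metis Ck_on.simps(2))
qed

lemma Ck_on_subset: "Ck_on k S f \<Longrightarrow> T \<subseteq> S \<Longrightarrow> Ck_on k T f"
proof (induction k arbitrary: f)
  case 0
  then show ?case by (auto intro: continuous_on_subset)
next
  case (Suc k)
  then show ?case by (auto simp: subset_iff)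
qed

lemma Ck_on_const: "Ck_on k S (\<lambda>_. c)"
  by (induction k arbitrary: c) auto

lemma Ck_on_bounded_linear:
  assumes "open S" "bounded_linear L" "Ck_on k S f"
  shows "Ck_on k S (\<lambda>x. L (f x))"
  using assms(3)
proof (induction k arbitrary: f)
  case 0
  then show ?case using assms(2) by (auto intro: bounded_linear.continuous_on)
next
  case (Suc k)
  show ?case
    by (rule Ck_on_SucI[OF assms(1) bounded_linear.has_derivative[OF assms(2) Ck_on_SucD(1)[OF Suc.prems]]])
      (auto intro: Suc.IH Ck_on_SucD(2)[OF Suc.prems])
qed

lemma Ck_on_add:
  assumes "open S" "Ck_on k S f" "Ck_on k S g"
  shows "Ck_on k S (\<lambda>x. f x + g x)"
  using assms(2,3)
proof (induction k arbitrary: f g)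
  case 0
  then show ?case by (auto intro: continuous_intros)
next
  case (Suc k)
  show ?case
    by (rule Ck_on_SucI[OF assms(1) has_derivative_add[OF Ck_on_SucD(1)[OF Suc.prems(1)] Ck_on_SucD(1)[OF Suc.prems(2)]]])
      (auto intro: Suc.IH Ck_on_SucD(2)[OF Suc.prems(1)] Ck_on_SucD(2)[OF Suc.prems(2)])
qed

lemma Ck_on_sum:
  assumes "open S" "\<And>i. i \<in> I \<Longrightarrow> Ck_on k S (f i)"
  shows "Ck_on k S (\<lambda>x. \<Sum>i\<in>I. f i x)"
  using assms(2) by (induction I rule: infinite_finite_induct) (auto intro: Ck_on_const Ck_on_add assms(1))

lemma Ck_on_bilinear:
  assumes "open S" "bounded_bilinear B" "Ck_on k S f" "Ck_on k S g"
  shows "Ck_on k S (\<lambda>x. B (f x) (g x))"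
  using assms(3,4)
proof (induction k arbitrary: f g)
  case 0
  then show ?case using assms(2) by (auto intro: bounded_bilinear.continuous_on)
next
  case (Suc k)
  show ?case
    by (rule Ck_on_SucI[OF assms(1) bounded_bilinear.FDERIV[OF assms(2) Ck_on_SucD(1)[OF Suc.prems(1)] Ck_on_SucD(1)[OF Suc.prems(2)]]])
      (auto intro!: Suc.IH Ck_on_add assms(1) Ck_on_SucD(2)[OF Suc.prems(1)] Ck_on_SucD(2)[OF Suc.prems(2)]
        Ck_on_Suc_imp[OF Suc.prems(1)] Ck_on_Suc_imp[OF Suc.prems(2)])
qed

text \<open>The chain rule alone does not suit the induction, because the direction of differentiation of the
  outer function then varies with the point. Expanding that direction in the standard basis turns the
  derivative into sums of products of functions to which the induction hypothesis applies.\<close>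

lemma Ck_on_compose:
  fixes f :: "'b::euclidean_space \<Rightarrow> 'c::real_normed_vector" and g :: "'a::euclidean_space \<Rightarrow> 'b"
  assumes "open S" "g ` S \<subseteq> T" "Ck_on k S g" "Ck_on k T f"
  shows "Ck_on k S (\<lambda>x. f (g x))"
  using assms(3,4)
proof (induction k arbitrary: f)
  case 0
  then show ?case using assms(2) continuous_on_compose2[of T f S g] by auto
next
  case (Suc k)
  have D: "((\<lambda>x. f (g x)) has_derivative
        (\<lambda>v. \<Sum>b\<in>Basis. (frechet_derivative g (at x) v \<bullet> b) *\<^sub>R frechet_derivative f (at (g x)) b)) (at x)"
    if "x \<in> S" for x
  proof -
    have f': "(f has_derivative frechet_derivative f (at (g x))) (at (g x))"
      by (rule Ck_on_SucD(1)[OF Suc.prems(2)]) (use assms(2) that in auto)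
    then have lin: "linear (frechet_derivative f (at (g x)))"
      using has_derivative_linear by blast
    have "frechet_derivative f (at (g x)) u = (\<Sum>b\<in>Basis. (u \<bullet> b) *\<^sub>R frechet_derivative f (at (g x)) b)" for u
    proof -
      have "frechet_derivative f (at (g x)) (\<Sum>b\<in>Basis. (u \<bullet> b) *\<^sub>R b) = (\<Sum>b\<in>Basis. (u \<bullet> b) *\<^sub>R frechet_derivative f (at (g x)) b)"
        by (simp add: linear_sum[OF lin] linear_cmul[OF lin])
      then show ?thesis by (simp add: euclidean_representation)
    qed
    then show ?thesis
      by (intro has_derivative_eq_rhs[OF has_derivative_compose[OF Ck_on_SucD(1)[OF Suc.prems(1) that] f']] ext)
  qed
  show ?case
  proof (rule Ck_on_SucI[OF assms(1) D], assumption)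
    show "Ck_on k S (\<lambda>x. \<Sum>b\<in>Basis. (frechet_derivative g (at x) v \<bullet> b) *\<^sub>R frechet_derivative f (at (g x)) b)" for v
      by (intro Ck_on_sum assms(1) Ck_on_bilinear[OF _ bounded_bilinear_scaleR]
          Ck_on_bounded_linear[OF _ bounded_linear_inner_left] Suc.IH
          Ck_on_Suc_imp[OF Suc.prems(1)] Ck_on_SucD(2)[OF Suc.prems(1)] Ck_on_SucD(2)[OF Suc.prems(2)])
  qed
qed

lemma Cinf_on_has_derivative:
  "Cinf_on S f \<Longrightarrow> x \<in> S \<Longrightarrow> (f has_derivative frechet_derivative f (at x)) (at x)"
  unfolding Cinf_on_def by (metis Ck_on_SucD(1))

lemma Cinf_on_derivative:
  "Cinf_on S f \<Longrightarrow> Cinf_on S (\<lambda>x. frechet_derivative f (at x) v)"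
  unfolding Cinf_on_def by (auto intro: Ck_on_SucD(2))

lemma Cinf_on_imp_continuous_on: "Cinf_on S f \<Longrightarrow> continuous_on S f"
  unfolding Cinf_on_def by (auto intro: Ck_on_imp_continuous_on)

lemma Cinf_on_cong:
  "open S \<Longrightarrow> (\<And>y. y \<in> S \<Longrightarrow> f y = g y) \<Longrightarrow> Cinf_on S f \<Longrightarrow> Cinf_on S g"
  unfolding Cinf_on_def by (auto intro: Ck_on_cong)

lemma Cinf_on_subset: "Cinf_on S f \<Longrightarrow> T \<subseteq> S \<Longrightarrow> Cinf_on T f"
  unfolding Cinf_on_def by (auto intro: Ck_on_subset)

lemma Cinf_on_const: "Cinf_on S (\<lambda>_. c)"
  unfolding Cinf_on_def by (simp add: Ck_on_const)

lemma Cinf_on_id: "open S \<Longrightarrow> Cinf_on S (\<lambda>x. x)"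
  unfolding Cinf_on_def
proof
  fix k assume "open S"
  show "Ck_on k S (\<lambda>x. x)"
  proof (cases k)
    case (Suc k)
    then show ?thesis using Ck_on_SucI[OF \<open>open S\<close> has_derivative_ident] by (simp add: Ck_on_const)
  qed simp
qed

lemma Cinf_on_bounded_linear:
  "open S \<Longrightarrow> bounded_linear L \<Longrightarrow> Cinf_on S f \<Longrightarrow> Cinf_on S (\<lambda>x. L (f x))"
  unfolding Cinf_on_def by (auto intro: Ck_on_bounded_linear)

lemma Cinf_on_add:
  "open S \<Longrightarrow> Cinf_on S f \<Longrightarrow> Cinf_on S g \<Longrightarrow> Cinf_on S (\<lambda>x. f x + g x)"
  unfolding Cinf_on_def by (auto intro: Ck_on_add)

lemma Cinf_on_sum:
  "open S \<Longrightarrow> (\<And>i. i \<in> I \<Longrightarrow> Cinf_on S (f i)) \<Longrightarrow> Cinf_on S (\<lambda>x. \<Sum>i\<in>I. f i x)"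
  unfolding Cinf_on_def by (blast intro: Ck_on_sum)

lemma Cinf_on_bilinear:
  "open S \<Longrightarrow> bounded_bilinear B \<Longrightarrow> Cinf_on S f \<Longrightarrow> Cinf_on S g \<Longrightarrow> Cinf_on S (\<lambda>x. B (f x) (g x))"
  unfolding Cinf_on_def by (auto intro: Ck_on_bilinear)

lemma Cinf_on_compose:
  fixes f :: "'b::euclidean_space \<Rightarrow> 'c::real_normed_vector" and g :: "'a::euclidean_space \<Rightarrow> 'b"
  assumes "open S" "g ` S \<subseteq> T" "Cinf_on S g" "Cinf_on T f"
  shows "Cinf_on S (\<lambda>x. f (g x))"
  using assms(3,4) unfolding Cinf_on_def
  by (blast intro: Ck_on_compose[OF assms(1,2), of _ f])

lemma ray_in_ball:
  fixes a :: "'a::real_normed_vector"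
  assumes "x \<in> ball a r" "t \<in> {0..1::real}"
  shows "a + t *\<^sub>R (x - a) \<in> ball a r"
proof -
  have "norm (t *\<^sub>R (x - a)) \<le> 1 * norm (x - a)"
    unfolding norm_scaleR by (rule mult_right_mono) (use assms in auto)
  then show ?thesis using assms by (simp add: dist_norm norm_minus_commute)
qed

text \<open>The weight \<open>t ^ m\<close> makes the class of ray integrals closed under differentiation: the inner
  derivative of \<open>a + t *\<^sub>R (x - a)\<close> only raises \<open>m\<close> by one. Smoothness of these integrals is then a plain induction
  on the order.\<close>

lemma ray_integral_has_derivative:
  fixes G :: "'a::euclidean_space \<Rightarrow> real"
  assumes "Cinf_on (ball a r) G" "x \<in> ball a r"
  shows "((\<lambda>x. integral {0..1} (\<lambda>t. t ^ m * G (a + t *\<^sub>R (x - a)))) has_derivative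
      (\<lambda>v. integral {0..1} (\<lambda>t. t ^ Suc m * frechet_derivative G (at (a + t *\<^sub>R (x - a))) v))) (at x)"
proof -
  let ?U = "ball a r"
  define fx where "fx = (\<lambda>x t. Blinfun (\<lambda>v. t ^ Suc m * frechet_derivative G (at (a + t *\<^sub>R (x - a))) v))"
  have G': "(G has_derivative frechet_derivative G (at y)) (at y)" if "y \<in> ?U" for y
    using Cinf_on_has_derivative[OF assms(1) that] .
  have fx: "blinfun_apply (fx x t) = (\<lambda>v. t ^ Suc m * frechet_derivative G (at (a + t *\<^sub>R (x - a))) v)"
    if "x \<in> ?U" "t \<in> {0..1}" for x t
    unfolding fx_def
    by (rule bounded_linear_Blinfun_apply)
      (intro bounded_linear_const_mult has_derivative_bounded_linear[OF G'[OF ray_in_ball[OF that]]])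
  have cont_comp: "continuous_on (?U \<times> {0..1}) (\<lambda>(x,t). H (a + t *\<^sub>R (x - a)))"
    if "continuous_on ?U H" for H :: "'a \<Rightarrow> real"
  proof -
    have "continuous_on (?U \<times> {0..1}) (\<lambda>p. H (a + snd p *\<^sub>R (fst p - a)))"
      by (rule continuous_on_compose2[OF that])
        (auto simp del: mem_ball intro!: continuous_intros ray_in_ball)
    then show ?thesis by (simp add: split_beta)
  qed
  have contG: "continuous_on ?U G" using Cinf_on_imp_continuous_on[OF assms(1)] .
  have cont: "continuous_on (?U \<times> cbox 0 1) (\<lambda>(x, t). fx x t)"
  proof (rule continuous_on_blinfun_componentwise)
    fix i :: 'a
    have "continuous_on (?U \<times> {0..1}) (\<lambda>(x,t). frechet_derivative G (at (a + t *\<^sub>R (x - a))) i)"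
      by (rule cont_comp[OF Cinf_on_imp_continuous_on[OF Cinf_on_derivative[OF assms(1)]]])
    then have "continuous_on (?U \<times> {0..1}) (\<lambda>p. snd p ^ Suc m * frechet_derivative G (at (a + snd p *\<^sub>R (fst p - a))) i)"
      by (auto simp: split_beta intro!: continuous_intros)
    then show "continuous_on (?U \<times> cbox 0 1) (\<lambda>x. blinfun_apply (case x of (x, t) \<Rightarrow> fx x t) i)"
      unfolding box_real by (rule continuous_on_eq) (use fx in \<open>auto simp del: mem_ball\<close>)
  qed
  have int: "(\<lambda>t. t ^ m * G (a + t *\<^sub>R (x - a))) integrable_on cbox 0 1" if "x \<in> ?U" for x
  proof -
    have "continuous_on {0..1} (\<lambda>t. G (a + t *\<^sub>R (x - a)))"
      by (rule continuous_on_compose2[OF contG]) (use that in \<open>auto simp del: mem_ball intro!: continuous_intros ray_in_ball\<close>)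
    then have "continuous_on {0..1} (\<lambda>t. t ^ m * G (a + t *\<^sub>R (x - a)))"
      by (intro continuous_intros)
    then show ?thesis by (simp add: integrable_continuous_real)
  qed
  have L: "((\<lambda>x. integral (cbox 0 1) (\<lambda>t. t ^ m * G (a + t *\<^sub>R (x - a)))) has_derivative
      blinfun_apply (integral (cbox 0 1) (fx x))) (at x within ?U)"
  proof (rule leibniz_rule[OF _ int cont assms(2)])
    fix y t assume yt: "y \<in> ?U" "t \<in> cbox (0::real) 1"
    then have t: "t \<in> {0..1}" by simp
    have "((\<lambda>y. G (a + t *\<^sub>R (y - a))) has_derivative (\<lambda>v. frechet_derivative G (at (a + t *\<^sub>R (y - a))) (t *\<^sub>R v))) (at y)"
      by (rule has_derivative_compose[where f = "\<lambda>y. a + t *\<^sub>R (y - a)" and g = G, OF _ G'[OF ray_in_ball[OF yt(1) t]]])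
         (auto intro!: derivative_eq_intros)
    then have "((\<lambda>y. t ^ m * G (a + t *\<^sub>R (y - a))) has_derivative (\<lambda>v. t ^ m * frechet_derivative G (at (a + t *\<^sub>R (y - a))) (t *\<^sub>R v))) (at y)"
      by (rule has_derivative_mult_right)
    moreover have "t ^ m * frechet_derivative G (at (a + t *\<^sub>R (y - a))) (t *\<^sub>R v) = blinfun_apply (fx y t) v" for v
      using linear_cmul[OF has_derivative_linear[OF G'[OF ray_in_ball[OF yt(1) t]]]] by (simp add: fx[OF yt(1) t])
    ultimately show "((\<lambda>y. t ^ m * G (a + t *\<^sub>R (y - a))) has_derivative blinfun_apply (fx y t)) (at y within ?U)"
      by (auto intro: has_derivative_at_withinI)
  qed auto
  have fxint: "fx x integrable_on cbox 0 1"
  proof (rule integrable_continuous)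
    have "continuous_on (cbox 0 1) (\<lambda>t. (\<lambda>(x, t). fx x t) (x, t))"
      by (rule continuous_on_compose2[OF cont]) (use assms(2) in \<open>auto intro!: continuous_intros\<close>)
    then show "continuous_on (cbox 0 1) (fx x)" by simp
  qed
  have "blinfun_apply (integral (cbox 0 1) (fx x)) v = integral {0..1} (\<lambda>t. t ^ Suc m * frechet_derivative G (at (a + t *\<^sub>R (x - a))) v)" for v
    unfolding box_real blinfun_apply_integral[OF fxint[unfolded box_real]]
    by (rule integral_cong) (simp add: fx[OF assms(2)])
  then have "blinfun_apply (integral (cbox 0 1) (fx x)) = (\<lambda>v. integral {0..1} (\<lambda>t. t ^ Suc m * frechet_derivative G (at (a + t *\<^sub>R (x - a))) v))"
    by auto
  then show ?thesis
    using L at_within_open[OF assms(2) open_ball] by simp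
qed

lemma Ck_on_ray_integral:
  fixes G :: "'a::euclidean_space \<Rightarrow> real"
  assumes "Cinf_on (ball a r) G"
  shows "Ck_on k (ball a r) (\<lambda>x. integral {0..1} (\<lambda>t. t ^ m * G (a + t *\<^sub>R (x - a))))"
  using assms
proof (induction k arbitrary: G m)
  case 0
  show ?case
    using has_derivative_continuous[OF ray_integral_has_derivative[OF 0, of _ m]]
    by (auto intro!: continuous_at_imp_continuous_on)
next
  case (Suc k)
  show ?case
    by (rule Ck_on_SucI[OF open_ball ray_integral_has_derivative[OF Suc.prems]])
      (auto intro!: Suc.IH[OF Cinf_on_derivative[OF Suc.prems], of "Suc _", unfolded power_Suc])
qed

text \<open>Hadamard's lemma: integrate the derivative of \<open>f\<close> along the segment from \<open>a\<close> to \<open>x\<close>. What matters later is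
  that the quotients \<open>h b\<close> are smooth again, since a derivation can then be applied to each product.\<close>

lemma Hadamard:
  fixes f :: "'a::euclidean_space \<Rightarrow> real"
  assumes "Cinf_on (ball a r) f" "0 < r"
  obtains h where "\<And>b. Cinf_on (ball a r) (h b)"
    "\<And>b. h b a = frechet_derivative f (at a) b"
    "\<And>x. x \<in> ball a r \<Longrightarrow> f x = f a + (\<Sum>b\<in>Basis. ((x - a) \<bullet> b) * h b x)"
proof
  (* By linearity in the direction, the integrand of f x - f a is a combination of the partial derivatives. *)
  define h where "h = (\<lambda>b x. integral {0..1} (\<lambda>t. frechet_derivative f (at (a + t *\<^sub>R (x - a))) b))"
  show "Cinf_on (ball a r) (h b)" for b
    unfolding Cinf_on_def h_def
    using Ck_on_ray_integral[OF Cinf_on_derivative[OF assms(1)], of _ 0 b] by simp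
  show "h b a = frechet_derivative f (at a) b" for b
    by (simp add: h_def)
  show "f x = f a + (\<Sum>b\<in>Basis. ((x - a) \<bullet> b) * h b x)" if x: "x \<in> ball a r" for x
  proof -
    let ?\<gamma> = "\<lambda>t. a + t *\<^sub>R (x - a)"
    have f': "(f has_derivative frechet_derivative f (at (?\<gamma> t))) (at (?\<gamma> t))" if "t \<in> {0..1}" for t
      by (rule Cinf_on_has_derivative[OF assms(1) ray_in_ball[OF x that]])
    have rep: "frechet_derivative f (at (?\<gamma> t)) (x - a) = (\<Sum>b\<in>Basis. ((x - a) \<bullet> b) * frechet_derivative f (at (?\<gamma> t)) b)"
      if "t \<in> {0..1}" for t
    proof -
      have lin: "linear (frechet_derivative f (at (?\<gamma> t)))" using has_derivative_linear[OF f'[OF that]] .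
      have "frechet_derivative f (at (?\<gamma> t)) (\<Sum>b\<in>Basis. ((x - a) \<bullet> b) *\<^sub>R b) = (\<Sum>b\<in>Basis. ((x - a) \<bullet> b) * frechet_derivative f (at (?\<gamma> t)) b)"
        by (simp add: linear_sum[OF lin] linear_cmul[OF lin])
      then show ?thesis by (simp add: euclidean_representation)
    qed
    have "((\<lambda>t. frechet_derivative f (at (?\<gamma> t)) (x - a)) has_integral (f (?\<gamma> 1) - f (?\<gamma> 0))) {0..1}"
    proof (rule fundamental_theorem_of_calculus)
      fix t :: real assume t: "t \<in> {0..1}"
      have "((\<lambda>t. f (?\<gamma> t)) has_derivative (\<lambda>s. frechet_derivative f (at (?\<gamma> t)) (s *\<^sub>R (x - a)))) (at t)"
        by (rule has_derivative_compose[where f = ?\<gamma> and g = f, OF _ f'[OF t]]) (auto intro!: derivative_eq_intros)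
      moreover have "frechet_derivative f (at (?\<gamma> t)) (s *\<^sub>R (x - a)) = s *\<^sub>R frechet_derivative f (at (?\<gamma> t)) (x - a)" for s
        using linear_cmul[OF has_derivative_linear[OF f'[OF t]]] .
      ultimately show "((\<lambda>t. f (?\<gamma> t)) has_vector_derivative frechet_derivative f (at (?\<gamma> t)) (x - a)) (at t within {0..1})"
        unfolding has_vector_derivative_def by (auto intro: has_derivative_at_withinI)
    qed simp
    then have eq: "f x - f a = integral {0..1} (\<lambda>t. frechet_derivative f (at (?\<gamma> t)) (x - a))"
      by (simp add: integral_unique)
    have int: "(\<lambda>t. frechet_derivative f (at (?\<gamma> t)) b) integrable_on {0..1}" for b
    proof -
      have "continuous_on {0..1} (\<lambda>t. frechet_derivative f (at (?\<gamma> t)) b)"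
        by (rule continuous_on_compose2[OF Cinf_on_imp_continuous_on[OF Cinf_on_derivative[OF assms(1)]]])
          (use x in \<open>auto simp del: mem_ball intro!: continuous_intros ray_in_ball\<close>)
      then show ?thesis by (rule integrable_continuous_real)
    qed
    have "integral {0..1} (\<lambda>t. frechet_derivative f (at (?\<gamma> t)) (x - a))
        = integral {0..1} (\<lambda>t. \<Sum>b\<in>Basis. ((x - a) \<bullet> b) * frechet_derivative f (at (?\<gamma> t)) b)"
      by (rule integral_cong) (rule rep)
    also have "\<dots> = (\<Sum>b\<in>Basis. ((x - a) \<bullet> b) * h b x)"
      unfolding h_def by (subst integral_sum) (auto intro!: integrable_on_mult_right int)
    finally show ?thesis using eq by simp
  qed
qed

section \<open>Charts and smooth maps on a manifold\<close>

locale manifold =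
  fixes A :: "('m::{t2_space, second_countable_topology}, 'n::finite) atlas"
  assumes manifold: "smooth_manifold A"
begin

lemma chart_at: obtains U \<phi> where "(U, \<phi>) \<in> A" "p \<in> U"
proof -
  have "p \<in> (\<Union>(U, \<phi>)\<in>A. U)" using manifold by (simp add: smooth_manifold_def)
  then show thesis using that by auto
qed

lemma chart:
  assumes "(U, \<phi>) \<in> A"
  shows "open U" "continuous_on U \<phi>" "inj_on \<phi> U" "q \<in> U \<Longrightarrow> inv_into U \<phi> (\<phi> q) = q"
    "(V, \<psi>) \<in> A \<Longrightarrow> Cinf_on (\<phi> ` (U \<inter> V)) (\<psi> \<circ> inv_into U \<phi>)"
proof -
  have *: "open U" "homeomorphism U (\<phi> ` U) \<phi> (inv_into U \<phi>)"
    using manifold assms unfolding smooth_manifold_def by auto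
  show "open U" "continuous_on U \<phi>" using * by (auto simp: homeomorphism_def)
  show "inj_on \<phi> U" by (rule inj_on_inverseI[of _ "inv_into U \<phi>"]) (use * in \<open>auto simp: homeomorphism_def\<close>)
  then show "q \<in> U \<Longrightarrow> inv_into U \<phi> (\<phi> q) = q" by simp
  show "(V, \<psi>) \<in> A \<Longrightarrow> Cinf_on (\<phi> ` (U \<inter> V)) (\<psi> \<circ> inv_into U \<phi>)"
    using manifold assms unfolding smooth_manifold_def by blast
qed

lemma open_chart_image:
  assumes "(U, \<phi>) \<in> A" "open S"
  shows "open (\<phi> ` (S \<inter> U))"
proof -
  have *: "open (\<phi> ` U)" "homeomorphism U (\<phi> ` U) \<phi> (inv_into U \<phi>)"
    using manifold assms unfolding smooth_manifold_def by auto
  have "openin (top_of_set U) (S \<inter> U)" using assms(2) by (metis openin_open_Int Int_commute)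
  then have "openin (top_of_set (\<phi> ` U)) (\<phi> ` (S \<inter> U))"
    using homeomorphism_imp_open_map[OF *(2)] by blast
  then show ?thesis using *(1) openin_open_trans by blast
qed

lemma smooth_map_onI:
  "(\<And>U \<phi>. (U, \<phi>) \<in> A \<Longrightarrow> Cinf_on (\<phi> ` (S \<inter> U)) (\<lambda>x. f (inv_into U \<phi> x))) \<Longrightarrow> smooth_map_on A S f"
  unfolding smooth_map_on_def by (auto simp: o_def)

lemma smooth_map_onD:
  "smooth_map_on A S f \<Longrightarrow> (U, \<phi>) \<in> A \<Longrightarrow> Cinf_on (\<phi> ` (S \<inter> U)) (\<lambda>x. f (inv_into U \<phi> x))"
  unfolding smooth_map_on_def by (auto simp: o_def)

lemma smooth_map_on_subset: "smooth_map_on A S f \<Longrightarrow> T \<subseteq> S \<Longrightarrow> smooth_map_on A T f"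
  by (rule smooth_map_onI, rule Cinf_on_subset[OF smooth_map_onD]) auto

lemma smooth_map_on_cong:
  assumes "open S" "\<And>q. q \<in> S \<Longrightarrow> f q = g q" "smooth_map_on A S f"
  shows "smooth_map_on A S g"
proof (rule smooth_map_onI)
  fix U \<phi> assume c: "(U, \<phi>) \<in> A"
  show "Cinf_on (\<phi> ` (S \<inter> U)) (\<lambda>x. g (inv_into U \<phi> x))"
    by (rule Cinf_on_cong[OF open_chart_image[OF c assms(1)] _ smooth_map_onD[OF assms(3) c]])
      (use chart(4)[OF c] assms(2) in auto)
qed

lemma smooth_map_on_const: "smooth_map_on A S (\<lambda>_. c)"
  by (rule smooth_map_onI) (rule Cinf_on_const)

lemma smooth_map_on_bounded_linear:
  "open S \<Longrightarrow> bounded_linear L \<Longrightarrow> smooth_map_on A S f \<Longrightarrow> smooth_map_on A S (\<lambda>x. L (f x))"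
  by (rule smooth_map_onI, rule Cinf_on_bounded_linear) (auto intro: open_chart_image smooth_map_onD)

lemma smooth_map_on_add:
  "open S \<Longrightarrow> smooth_map_on A S f \<Longrightarrow> smooth_map_on A S g \<Longrightarrow> smooth_map_on A S (\<lambda>x. f x + g x)"
  by (rule smooth_map_onI, rule Cinf_on_add) (auto intro: open_chart_image smooth_map_onD)

lemma smooth_map_on_sum:
  "open S \<Longrightarrow> (\<And>i. i \<in> I \<Longrightarrow> smooth_map_on A S (f i)) \<Longrightarrow> smooth_map_on A S (\<lambda>x. \<Sum>i\<in>I. f i x)"
  by (rule smooth_map_onI, rule Cinf_on_sum) (auto intro: open_chart_image smooth_map_onD)

lemma smooth_map_on_bilinear:
  "open S \<Longrightarrow> bounded_bilinear B \<Longrightarrow> smooth_map_on A S f \<Longrightarrow> smooth_map_on A S g \<Longrightarrow>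
    smooth_map_on A S (\<lambda>x. B (f x) (g x))"
  by (rule smooth_map_onI, rule Cinf_on_bilinear) (auto intro: open_chart_image smooth_map_onD)

lemmas smooth_map_on_mult = smooth_map_on_bilinear[OF _ bounded_bilinear_mult]
lemmas smooth_map_on_Re = smooth_map_on_bounded_linear[OF _ bounded_linear_Re]
lemmas smooth_map_on_Im = smooth_map_on_bounded_linear[OF _ bounded_linear_Im]
lemmas smooth_map_on_nth = smooth_map_on_bounded_linear[OF _ bounded_linear_vec_nth]

lemma smooth_map_on_vec:
  fixes f :: "'k::finite \<Rightarrow> 'm \<Rightarrow> 'c::euclidean_space"
  assumes "open S" "\<And>k. smooth_map_on A S (f k)"
  shows "smooth_map_on A S (\<lambda>q. \<chi> k. f k q)"
proof -
  have "bounded_linear (axis k :: 'c \<Rightarrow> 'c ^ 'k)" for k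
    unfolding linear_conv_bounded_linear[symmetric]
    by (rule linearI) (auto simp: axis_def vec_eq_iff)
  then have "smooth_map_on A S (\<lambda>q. \<Sum>k\<in>UNIV. axis k (f k q))"
    by (intro smooth_map_on_sum[OF assms(1)] smooth_map_on_bounded_linear[OF assms(1) _ assms(2)])
  moreover have "(\<Sum>k\<in>UNIV. axis k (f k q)) = (\<chi> k. f k q)" for q
    by (simp add: vec_eq_iff axis_def)
  ultimately show ?thesis by simp
qed

text \<open>Smoothness is required in every chart of the atlas; for a function given in a single chart it is
  supplied by the transition maps.\<close>

lemma smooth_map_on_chart:
  assumes c: "(U, \<phi>) \<in> A" and "open V" "V \<subseteq> U" "\<phi> ` V \<subseteq> T" "Cinf_on T h"
  shows "smooth_map_on A V (\<lambda>q. h (\<phi> q))"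
proof (rule smooth_map_onI)
  fix U' \<psi> assume c': "(U', \<psi>) \<in> A"
  have tr: "Cinf_on (\<psi> ` (V \<inter> U')) (\<lambda>x. \<phi> (inv_into U' \<psi> x))"
    by (rule Cinf_on_subset[OF chart(5)[OF c' c, unfolded o_def]]) (use assms in auto)
  show "Cinf_on (\<psi> ` (V \<inter> U')) (\<lambda>x. h (\<phi> (inv_into U' \<psi> x)))"
    by (rule Cinf_on_compose[OF open_chart_image[OF c' assms(2)] _ tr assms(5)])
      (use chart(4)[OF c'] assms(4) in auto)
qed

lemma smooth_nearI: "open S \<Longrightarrow> p \<in> S \<Longrightarrow> smooth_map_on A S f \<Longrightarrow> smooth_near A p f"
  unfolding smooth_near_def by blast

lemma smooth_near_const: "smooth_near A p (\<lambda>_. c)"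
  using smooth_map_on_const by (intro smooth_nearI[of UNIV]) auto

lemma smooth_near_bounded_linear:
  "bounded_linear L \<Longrightarrow> smooth_near A p f \<Longrightarrow> smooth_near A p (\<lambda>q. L (f q))"
  unfolding smooth_near_def using smooth_map_on_bounded_linear by blast

lemma smooth_near_two:
  assumes "smooth_near A p f" "smooth_near A p g"
  obtains S where "open S" "p \<in> S" "smooth_map_on A S f" "smooth_map_on A S g"
proof -
  obtain S T where "open S" "p \<in> S" "smooth_map_on A S f" "open T" "p \<in> T" "smooth_map_on A T g"
    using assms unfolding smooth_near_def by auto
  then show thesis by (intro that[of "S \<inter> T"]) (auto intro: smooth_map_on_subset)
qed

lemma smooth_near_add:
  assumes "smooth_near A p f" "smooth_near A p g"
  shows "smooth_near A p (\<lambda>q. f q + g q)"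
proof -
  obtain S where "open S" "p \<in> S" "smooth_map_on A S f" "smooth_map_on A S g"
    using smooth_near_two[OF assms] .
  then show ?thesis by (intro smooth_nearI[of S] smooth_map_on_add)
qed

lemma smooth_near_bilinear:
  assumes "bounded_bilinear B" "smooth_near A p f" "smooth_near A p g"
  shows "smooth_near A p (\<lambda>q. B (f q) (g q))"
proof -
  obtain S where "open S" "p \<in> S" "smooth_map_on A S f" "smooth_map_on A S g"
    using smooth_near_two[OF assms(2,3)] .
  then show ?thesis by (blast intro: smooth_nearI smooth_map_on_bilinear[OF _ assms(1), of S f g])
qed

lemma smooth_near_sum:
  "(\<And>i. i \<in> I \<Longrightarrow> smooth_near A p (f i)) \<Longrightarrow> smooth_near A p (\<lambda>q. \<Sum>i\<in>I. f i q)"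
proof (induction I rule: infinite_finite_induct)
  case (insert i I)
  then have "smooth_near A p (\<lambda>q. f i q + (\<Sum>i\<in>I. f i q))" by (intro smooth_near_add) auto
  then show ?case using insert by simp
qed (simp_all add: smooth_near_const)

lemmas smooth_near_mult = smooth_near_bilinear[OF bounded_bilinear_mult]
lemmas smooth_near_Re = smooth_near_bounded_linear[OF bounded_linear_Re]
lemmas smooth_near_Im = smooth_near_bounded_linear[OF bounded_linear_Im]
lemmas smooth_near_nth = smooth_near_bounded_linear[OF bounded_linear_vec_nth]

section \<open>Tangent vectors as derivations\<close>

lemma tangentD:
  assumes "v \<in> tangent_space A p"
  shows "smooth_near A p f \<Longrightarrow> smooth_near A p h \<Longrightarrow> v (\<lambda>q. f q + h q) = v f + v h"
    and "smooth_near A p f \<Longrightarrow> smooth_near A p h \<Longrightarrow> v (\<lambda>q. f q * h q) = f p * v h + h p * v f"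
    and "smooth_near A p f \<Longrightarrow> v (\<lambda>q. c * f q) = c * v f"
    and "smooth_near A p f \<Longrightarrow> smooth_near A p h \<Longrightarrow> (\<forall>\<^sub>F q in nhds p. f q = h q) \<Longrightarrow> v f = v h"
    and "\<not> smooth_near A p f \<Longrightarrow> v f = 0"
  using assms unfolding tangent_space_def by blast+

lemma tangentI:
  assumes "\<And>f h. smooth_near A p f \<Longrightarrow> smooth_near A p h \<Longrightarrow> v (\<lambda>q. f q + h q) = v f + v h"
    and "\<And>f h. smooth_near A p f \<Longrightarrow> smooth_near A p h \<Longrightarrow> v (\<lambda>q. f q * h q) = f p * v h + h p * v f"
    and "\<And>c f. smooth_near A p f \<Longrightarrow> v (\<lambda>q. c * f q) = c * v f"
    and "\<And>f h. smooth_near A p f \<Longrightarrow> smooth_near A p h \<Longrightarrow> (\<forall>\<^sub>F q in nhds p. f q = h q) \<Longrightarrow> v f = v h"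
    and "\<And>f. \<not> smooth_near A p f \<Longrightarrow> v f = 0"
  shows "v \<in> tangent_space A p"
  unfolding tangent_space_def mem_Collect_eq by (intro conjI allI impI assms)

lemma tangent_const:
  assumes "v \<in> tangent_space A p"
  shows "v (\<lambda>_. c) = 0"
proof -
  (* The product rule for 1 = 1 * 1. *)
  have "v (\<lambda>_. 1) = 0"
    using tangentD(2)[OF assms smooth_near_const smooth_near_const, of 1 1] by simp
  then show ?thesis
    using tangentD(3)[OF assms smooth_near_const, of c 1] by simp
qed

lemma tangent_sum:
  assumes "v \<in> tangent_space A p" "\<And>i. i \<in> I \<Longrightarrow> smooth_near A p (f i)"
  shows "v (\<lambda>q. \<Sum>i\<in>I. f i q) = (\<Sum>i\<in>I. v (f i))"
  using assms(2)
proof (induction I rule: infinite_finite_induct)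
  case (insert x F)
  then have "v (\<lambda>q. f x q + (\<Sum>i\<in>F. f i q)) = v (f x) + v (\<lambda>q. \<Sum>i\<in>F. f i q)"
    by (intro tangentD(1)[OF assms(1)] smooth_near_sum) auto
  then show ?case using insert by simp
qed (use tangent_const[OF assms(1), of 0] in auto)

lemma tangent_combination:
  assumes "u \<in> tangent_space A p" "v \<in> tangent_space A p"
  shows "(\<lambda>f. a * u f + b * v f) \<in> tangent_space A p"
proof (rule tangentI)
  fix f h :: "'m \<Rightarrow> real" assume fh: "smooth_near A p f" "smooth_near A p h"
  show "a * u (\<lambda>q. f q + h q) + b * v (\<lambda>q. f q + h q) = a * u f + b * v f + (a * u h + b * v h)"
    unfolding tangentD(1)[OF assms(1) fh] tangentD(1)[OF assms(2) fh] by (simp add: algebra_simps)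
  show "a * u (\<lambda>q. f q * h q) + b * v (\<lambda>q. f q * h q) = f p * (a * u h + b * v h) + h p * (a * u f + b * v f)"
    unfolding tangentD(2)[OF assms(1) fh] tangentD(2)[OF assms(2) fh] by (simp add: algebra_simps)
  show "a * u f + b * v f = a * u h + b * v h" if "\<forall>\<^sub>F q in nhds p. f q = h q"
    using tangentD(4)[OF assms(1) fh that] tangentD(4)[OF assms(2) fh that] by simp
next
  fix c and f :: "'m \<Rightarrow> real" assume f: "smooth_near A p f"
  show "a * u (\<lambda>q. c * f q) + b * v (\<lambda>q. c * f q) = c * (a * u f + b * v f)"
    unfolding tangentD(3)[OF assms(1) f] tangentD(3)[OF assms(2) f] by (simp add: algebra_simps)
next
  fix f :: "'m \<Rightarrow> real" assume f: "\<not> smooth_near A p f"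
  show "a * u f + b * v f = 0"
    unfolding tangentD(5)[OF assms(1) f] tangentD(5)[OF assms(2) f] by simp
qed

text \<open>The directional derivative along \<open>u\<close> in the chart \<open>\<phi>\<close>, with the value \<open>0\<close> on non-smooth functions that
  \<open>tangent_space\<close> prescribes.\<close>

definition chart_vector :: "'m set \<Rightarrow> ('m \<Rightarrow> real ^ 'n) \<Rightarrow> real ^ 'n \<Rightarrow> 'm \<Rightarrow> ('m \<Rightarrow> real) \<Rightarrow> real" where
  "chart_vector U \<phi> u q f =
    (if smooth_near A q f then frechet_derivative (\<lambda>x. f (inv_into U \<phi> x)) (at (\<phi> q)) u else 0)"

lemma chart_derivative:
  assumes "(U, \<phi>) \<in> A" "q \<in> U" "smooth_near A q f"
  shows "((\<lambda>x. f (inv_into U \<phi> x)) has_derivative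
    frechet_derivative (\<lambda>x. f (inv_into U \<phi> x)) (at (\<phi> q))) (at (\<phi> q))"
proof -
  obtain S where "open S" "q \<in> S" "smooth_map_on A S f" using assms(3) unfolding smooth_near_def by auto
  then show ?thesis
    using smooth_map_onD[OF _ assms(1), of S f] assms(2)
    by (intro Cinf_on_has_derivative[of "\<phi> ` (S \<inter> U)"]) auto
qed

lemma chart_vector_eq:
  assumes "(U, \<phi>) \<in> A" "q \<in> U" "smooth_near A q f"
    "((\<lambda>x. f (inv_into U \<phi> x)) has_derivative D) (at (\<phi> q))"
  shows "chart_vector U \<phi> u q f = D u"
  using assms(3) frechet_derivative_eqI[OF assms(4)] unfolding chart_vector_def by simp

lemma chart_vector_tangent:
  assumes c: "(U, \<phi>) \<in> A" and q: "q \<in> U"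
  shows "chart_vector U \<phi> u q \<in> tangent_space A q"
proof (rule tangentI)
  note cd = chart_derivative[OF assms]
  have cv: "smooth_near A q f \<Longrightarrow> chart_vector U \<phi> u q f = frechet_derivative (\<lambda>x. f (inv_into U \<phi> x)) (at (\<phi> q)) u" for f
    by (simp add: chart_vector_def)
  show "chart_vector U \<phi> u q (\<lambda>q. f q + h q) = chart_vector U \<phi> u q f + chart_vector U \<phi> u q h"
    if "smooth_near A q f" "smooth_near A q h" for f h
    using chart_vector_eq[OF assms smooth_near_add[OF that] has_derivative_add[OF cd[OF that(1)] cd[OF that(2)]]]
    by (simp add: cv that)
  show "chart_vector U \<phi> u q (\<lambda>q. f q * h q) = f q * chart_vector U \<phi> u q h + h q * chart_vector U \<phi> u q f"
    if "smooth_near A q f" "smooth_near A q h" for f h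
    using chart_vector_eq[OF assms smooth_near_mult[OF that] has_derivative_mult[OF cd[OF that(1)] cd[OF that(2)]]]
    by (simp add: cv that chart(4)[OF assms])
  show "chart_vector U \<phi> u q (\<lambda>q. k * f q) = k * chart_vector U \<phi> u q f"
    if "smooth_near A q f" for f k
    using chart_vector_eq[OF assms smooth_near_mult[OF smooth_near_const that] has_derivative_mult_right[OF cd[OF that]]]
    by (simp add: cv that)
  show "chart_vector U \<phi> u q f = chart_vector U \<phi> u q h"
    if "smooth_near A q f" "smooth_near A q h" and ev: "\<forall>\<^sub>F q in nhds q. f q = h q" for f h
  proof -
    obtain T where T: "open T" "q \<in> T" "\<And>y. y \<in> T \<Longrightarrow> f y = h y"
      using ev unfolding eventually_nhds by auto
    have "frechet_derivative (\<lambda>x. f (inv_into U \<phi> x)) (at (\<phi> q)) = frechet_derivative (\<lambda>x. h (inv_into U \<phi> x)) (at (\<phi> q))"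
      by (rule frechet_derivative_cong_open[OF open_chart_image[OF c T(1)]])
        (use T q chart(4)[OF c] in auto)
    then show ?thesis by (simp add: cv that)
  qed
  show "chart_vector U \<phi> u q f = 0" if "\<not> smooth_near A q f" for f
    using that by (simp add: chart_vector_def)
qed

lemma chart_vector_smooth:
  assumes c: "(U, \<phi>) \<in> A" and V: "open V" "V \<subseteq> U" and f: "smooth_map_on A V f"
  shows "smooth_map_on A V (\<lambda>q. chart_vector U \<phi> u q f)"
proof (rule smooth_map_on_cong[OF V(1)])
  show "smooth_map_on A V (\<lambda>q. frechet_derivative (\<lambda>x. f (inv_into U \<phi> x)) (at (\<phi> q)) u)"
    by (rule smooth_map_on_chart[OF c V, where T = "\<phi> ` (V \<inter> U)"])
      (use V in \<open>auto intro!: Cinf_on_derivative smooth_map_onD[OF f c]\<close>)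
  show "frechet_derivative (\<lambda>x. f (inv_into U \<phi> x)) (at (\<phi> q)) u = chart_vector U \<phi> u q f" if "q \<in> V" for q
    using smooth_nearI[OF V(1) that f] by (simp add: chart_vector_def)
qed

lemma coordinate_smooth_near:
  assumes c: "(U, \<phi>) \<in> A" and "p \<in> U"
  shows "smooth_near A p (\<lambda>q. \<phi> q \<bullet> b)"
  by (rule smooth_nearI[OF chart(1)[OF c] assms(2)],
      rule smooth_map_on_chart[OF c chart(1)[OF c], where T = UNIV])
    (auto intro!: Cinf_on_bounded_linear[OF _ bounded_linear_inner_left] Cinf_on_id)

text \<open>Apply \<open>v\<close> to the Hadamard expansion of \<open>f\<close> at \<open>p\<close>: the coordinate differences vanish at \<open>p\<close>, so the
  product rule leaves only the values of \<open>v\<close> on the coordinates, weighted by the partial derivatives of \<open>f\<close>.\<close>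

lemma tangent_eq_chart_vector:
  assumes c: "(U, \<phi>) \<in> A" and p: "p \<in> U" and v: "v \<in> tangent_space A p"
  shows "v = chart_vector U \<phi> (\<Sum>b\<in>Basis. v (\<lambda>q. \<phi> q \<bullet> b) *\<^sub>R b) p"
proof
  fix f
  show "v f = chart_vector U \<phi> (\<Sum>b\<in>Basis. v (\<lambda>q. \<phi> q \<bullet> b) *\<^sub>R b) p f"
  proof (cases "smooth_near A p f")
    case False
    then show ?thesis using tangentD(5)[OF v] by (simp add: chart_vector_def)
  next
    case True
    let ?f = "\<lambda>x. f (inv_into U \<phi> x)"
    obtain S where S: "open S" "p \<in> S" "smooth_map_on A S f" using True unfolding smooth_near_def by auto
    have "\<phi> p \<in> \<phi> ` (S \<inter> U)" using p S(2) by blast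
    then obtain r where r: "r > 0" "ball (\<phi> p) r \<subseteq> \<phi> ` (S \<inter> U)"
      using open_chart_image[OF c S(1)] open_contains_ball by metis
    obtain h where h: "\<And>b. Cinf_on (ball (\<phi> p) r) (h b)"
      "\<And>b. h b (\<phi> p) = frechet_derivative ?f (at (\<phi> p)) b"
      "\<And>x. x \<in> ball (\<phi> p) r \<Longrightarrow> ?f x = ?f (\<phi> p) + (\<Sum>b\<in>Basis. ((x - \<phi> p) \<bullet> b) * h b x)"
      by (rule Hadamard[OF Cinf_on_subset[OF smooth_map_onD[OF S(3) c] r(2)] r(1)], rule that)
    (* The neighbourhood of p on which the expansion holds; germs at p do not see the rest. *)
    define V where "V = U \<inter> \<phi> -` ball (\<phi> p) r"
    have V: "open V" "p \<in> V" "V \<subseteq> U"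
      using continuous_open_preimage[OF chart(2,1)[OF c] open_ball] p r by (auto simp: V_def)
    have hs: "smooth_near A p (\<lambda>q. h b (\<phi> q))" for b
      by (rule smooth_nearI[OF V(1,2)], rule smooth_map_on_chart[OF c V(1,3) _ h(1)]) (auto simp: V_def)
    have ls: "smooth_near A p (\<lambda>q. \<phi> q \<bullet> b + - (\<phi> p \<bullet> b))" for b
      by (intro smooth_near_add coordinate_smooth_near[OF c p] smooth_near_const)
    have ts: "smooth_near A p (\<lambda>q. (\<phi> q \<bullet> b + - (\<phi> p \<bullet> b)) * h b (\<phi> q))" for b
      by (rule smooth_near_mult[OF ls hs])
    have "f q = f p + (\<Sum>b\<in>Basis. (\<phi> q \<bullet> b + - (\<phi> p \<bullet> b)) * h b (\<phi> q))" if "q \<in> V" for q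
      using h(3)[of "\<phi> q"] that chart(4)[OF c] p by (simp add: V_def inner_diff_left)
    then have "\<forall>\<^sub>F q in nhds p. f q = f p + (\<Sum>b\<in>Basis. (\<phi> q \<bullet> b + - (\<phi> p \<bullet> b)) * h b (\<phi> q))"
      unfolding eventually_nhds by (intro exI[of _ V] conjI ballI V)
    then have "v f = v (\<lambda>q. f p + (\<Sum>b\<in>Basis. (\<phi> q \<bullet> b + - (\<phi> p \<bullet> b)) * h b (\<phi> q)))"
      by (intro tangentD(4)[OF v True] smooth_near_add smooth_near_const smooth_near_sum ts)
    also have "\<dots> = (\<Sum>b\<in>Basis. v (\<lambda>q. (\<phi> q \<bullet> b + - (\<phi> p \<bullet> b)) * h b (\<phi> q)))"
      unfolding tangentD(1)[OF v smooth_near_const smooth_near_sum[OF ts]] tangent_sum[OF v ts]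
      by (simp add: tangent_const[OF v])
    also have "\<dots> = (\<Sum>b\<in>Basis. v (\<lambda>q. \<phi> q \<bullet> b) * h b (\<phi> p))"
    proof (rule sum.cong[OF refl])
      fix b
      have "v (\<lambda>q. \<phi> q \<bullet> b + - (\<phi> p \<bullet> b)) = v (\<lambda>q. \<phi> q \<bullet> b)"
        using tangentD(1)[OF v coordinate_smooth_near[OF c p] smooth_near_const, of b "- (\<phi> p \<bullet> b)"]
          tangent_const[OF v, of "- (\<phi> p \<bullet> b)"] by simp
      then show "v (\<lambda>q. (\<phi> q \<bullet> b + - (\<phi> p \<bullet> b)) * h b (\<phi> q)) = v (\<lambda>q. \<phi> q \<bullet> b) * h b (\<phi> p)"
        using tangentD(2)[OF v ls hs, of b b] by simp
    qed
    also have "\<dots> = frechet_derivative ?f (at (\<phi> p)) (\<Sum>b\<in>Basis. v (\<lambda>q. \<phi> q \<bullet> b) *\<^sub>R b)"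
      using has_derivative_linear[OF chart_derivative[OF c p True]]
      by (simp add: h(2) linear_sum linear_cmul)
    finally show ?thesis using True by (simp add: chart_vector_def)
  qed
qed

section \<open>Complex tangent vectors\<close>

lemma ctangentI:
  "u \<in> tangent_space A p \<Longrightarrow> v \<in> tangent_space A p \<Longrightarrow> (\<lambda>f. complex_of_real (u f) + \<i> * complex_of_real (v f)) \<in> ctangent_space A p"
  by (simp add: ctangent_space_def)

lemma zero_tangent: "(\<lambda>_. 0) \<in> tangent_space A p"
  by (auto simp: tangent_space_def)

lemma complexify_ctangent: "v \<in> tangent_space A p \<Longrightarrow> complexify v \<in> ctangent_space A p"
  using ctangentI[OF _ zero_tangent] by (simp add: complexify_def)

lemma ctangent_combination:
  assumes "u \<in> ctangent_space A p" "v \<in> ctangent_space A p"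
  shows "(\<lambda>f. a * u f + b * v f) \<in> ctangent_space A p"
proof -
  note t = assms[unfolded ctangent_space_def mem_Collect_eq]
  note c = tangent_combination
  have "(\<lambda>f. 1 * (Re a * Re (u f) + - Im a * Im (u f)) + 1 * (Re b * Re (v f) + - Im b * Im (v f))) \<in> tangent_space A p"
    by (rule c[OF c[OF t(1)[THEN conjunct1] t(1)[THEN conjunct2]] c[OF t(2)[THEN conjunct1] t(2)[THEN conjunct2]]])
  moreover have "(\<lambda>f. 1 * (Re a * Im (u f) + Im a * Re (u f)) + 1 * (Re b * Im (v f) + Im b * Re (v f))) \<in> tangent_space A p"
    by (rule c[OF c[OF t(1)[THEN conjunct2] t(1)[THEN conjunct1]] c[OF t(2)[THEN conjunct2] t(2)[THEN conjunct1]]])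
  ultimately show ?thesis unfolding ctangent_space_def by (simp add: algebra_simps)
qed

lemma zero_ctangent: "(\<lambda>_. 0) \<in> ctangent_space A p"
  using zero_tangent by (simp add: ctangent_space_def)

lemma ctangent_sum:
  assumes "\<And>i. i \<in> I \<Longrightarrow> E i \<in> ctangent_space A p"
  shows "(\<lambda>f. \<Sum>i\<in>I. c i * E i f) \<in> ctangent_space A p"
  using assms
proof (induction I rule: infinite_finite_induct)
  case (insert x F)
  then show ?case using ctangent_combination[of "E x" p "\<lambda>f. \<Sum>i\<in>F. c i * E i f" "c x" 1] by simp
qed (auto intro: zero_ctangent)

lemma ctangentD:
  assumes "w \<in> ctangent_space A p"
  shows "smooth_near A p f \<Longrightarrow> smooth_near A p h \<Longrightarrow> w (\<lambda>q. f q + h q) = w f + w h"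
    and "smooth_near A p f \<Longrightarrow> smooth_near A p h \<Longrightarrow> w (\<lambda>q. f q * h q) = f p * w h + h p * w f"
    and "smooth_near A p f \<Longrightarrow> w (\<lambda>q. c * f q) = c * w f"
    and "smooth_near A p f \<Longrightarrow> smooth_near A p h \<Longrightarrow> (\<forall>\<^sub>F q in nhds p. f q = h q) \<Longrightarrow> w f = w h"
    and "w (\<lambda>_. c) = 0"
proof -
  note t = assms[unfolded ctangent_space_def mem_Collect_eq]
  note r = t[THEN conjunct1] and i = t[THEN conjunct2]
  show "smooth_near A p f \<Longrightarrow> smooth_near A p h \<Longrightarrow> w (\<lambda>q. f q + h q) = w f + w h"
    using tangentD(1)[OF r, of f h] tangentD(1)[OF i, of f h] by (simp add: complex_eq_iff)
  show "smooth_near A p f \<Longrightarrow> smooth_near A p h \<Longrightarrow> w (\<lambda>q. f q * h q) = f p * w h + h p * w f"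
    using tangentD(2)[OF r, of f h] tangentD(2)[OF i, of f h] by (simp add: complex_eq_iff)
  show "smooth_near A p f \<Longrightarrow> w (\<lambda>q. c * f q) = c * w f"
    using tangentD(3)[OF r, of f c] tangentD(3)[OF i, of f c] by (simp add: complex_eq_iff)
  show "smooth_near A p f \<Longrightarrow> smooth_near A p h \<Longrightarrow> (\<forall>\<^sub>F q in nhds p. f q = h q) \<Longrightarrow> w f = w h"
    using tangentD(4)[OF r, of f h] tangentD(4)[OF i, of f h] by (simp add: complex_eq_iff)
  show "w (\<lambda>_. c) = 0"
    using tangent_const[OF r, of c] tangent_const[OF i, of c] by (simp add: complex_eq_iff)
qed

text \<open>A field with constant coefficients in a chart around \<open>p\<close>. This lets identities proved for vector fields be
  used for single tangent vectors.\<close>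

lemma ctangent_extend:
  assumes w: "w \<in> ctangent_space A p"
  obtains Y where "vector_field_near A p Y" "Y p = w"
proof -
  obtain U \<phi> where c: "(U, \<phi>) \<in> A" and p: "p \<in> U" by (rule chart_at)
  obtain a where a: "(\<lambda>f. Re (w f)) = chart_vector U \<phi> a p"
    using tangent_eq_chart_vector[OF c p] w unfolding ctangent_space_def by blast
  obtain b where b: "(\<lambda>f. Im (w f)) = chart_vector U \<phi> b p"
    using tangent_eq_chart_vector[OF c p] w unfolding ctangent_space_def by blast
  let ?Y = "\<lambda>q f. complex_of_real (chart_vector U \<phi> a q f) + \<i> * complex_of_real (chart_vector U \<phi> b q f)"
  have "vector_field_on A U ?Y"
    unfolding vector_field_on_def
    by (auto intro!: ctangentI chart_vector_tangent[OF c] smooth_map_on_add smooth_map_on_mult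
      smooth_map_on_const smooth_map_on_bounded_linear[OF _ bounded_linear_of_real] chart_vector_smooth[OF c])
  then have "vector_field_near A p ?Y"
    unfolding vector_field_near_def using chart(1)[OF c] p by blast
  moreover have "?Y p = w"
  proof
    fix f show "?Y p f = w f"
      using fun_cong[OF a, of f] fun_cong[OF b, of f] by (simp add: complex_eq_iff)
  qed
  ultimately show thesis by (rule that)
qed

text \<open>The coordinate vectors; they are separated by the coordinate functions.\<close>

lemma ctangent_independent:
  obtains E :: "'n \<Rightarrow> 'm ctvec" where "\<And>i. E i \<in> ctangent_space A p"
    "\<And>c i. (\<lambda>f. \<Sum>i\<in>UNIV. c i * E i f) = (\<lambda>_. 0) \<Longrightarrow> c i = 0"
proof -
  obtain U \<phi> where c: "(U, \<phi>) \<in> A" and p: "p \<in> U" by (rule chart_at)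
  define E where "E = (\<lambda>i. complexify (chart_vector U \<phi> (axis i 1) p))"
  have "E i \<in> ctangent_space A p" for i
    unfolding E_def by (intro complexify_ctangent chart_vector_tangent c p)
  moreover have "k i = 0" if k: "(\<lambda>f. \<Sum>i\<in>UNIV. k i * E i f) = (\<lambda>_. 0)" for k i
  proof -
    have "((\<lambda>x. x $ i) has_derivative (\<lambda>u. u $ i)) (at (\<phi> p))"
      by (rule bounded_linear_imp_has_derivative) (rule bounded_linear_vec_nth)
    then have "((\<lambda>x. \<phi> (inv_into U \<phi> x) \<bullet> axis i 1) has_derivative (\<lambda>u. u $ i)) (at (\<phi> p))"
      by (rule has_derivative_transform_within_open[OF _ open_chart_image[OF c chart(1)[OF c]]])
        (use p chart(4)[OF c] in \<open>auto simp: inner_axis\<close>)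
    then have E: "E j (\<lambda>q. \<phi> q \<bullet> axis i 1) = (if j = i then 1 else 0)" for j
      using chart_vector_eq[OF c p coordinate_smooth_near[OF c p], of "axis i 1"]
      by (simp add: E_def complexify_def axis_def)
    show ?thesis
      using fun_cong[OF k, of "\<lambda>q. \<phi> q \<bullet> axis i 1"] unfolding E by (simp add: if_distrib cong: if_cong)
  qed
  ultimately show thesis by (rule that)
qed

end

section \<open>The complex bilinear form and the connection of the quadric\<close>

lemma cbilin_commute: "cbilin x y = cbilin y x"
  by (simp add: cbilin_def mult.commute)

lemma cbilin_add_left: "cbilin (x + y) z = cbilin x z + cbilin y z"
  and cbilin_add_right: "cbilin z (x + y) = cbilin z x + cbilin z y"
  and cbilin_diff_left: "cbilin (x - y) z = cbilin x z - cbilin y z"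
  and cbilin_diff_right: "cbilin z (x - y) = cbilin z x - cbilin z y"
  and cbilin_scale_left: "cbilin (a *s x) z = a * cbilin x z"
  and cbilin_scale_right: "cbilin z (a *s x) = a * cbilin z x"
  and cbilin_zero_left: "cbilin 0 z = 0"
  and cbilin_zero_right: "cbilin z 0 = 0"
  for x y z :: "complex ^ 'k"
  by (simp_all add: cbilin_def algebra_simps sum.distrib sum_subtractf sum_distrib_left)

lemmas cbilin_algebra = cbilin_add_left cbilin_add_right cbilin_diff_left cbilin_diff_right
  cbilin_scale_left cbilin_scale_right cbilin_zero_left cbilin_zero_right

lemma cbilin_axis_left: "cbilin (axis k a) x = a * x $ k"
proof -
  have "cbilin (axis k a) x = (\<Sum>i\<in>UNIV. if i = k then a * x $ k else 0)"
    unfolding cbilin_def by (rule sum.cong) (auto simp: axis_def)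
  then show ?thesis by simp
qed

lemma cbilin_nondegenerate:
  assumes "\<And>w. cbilin x w = 0"
  shows "x = 0"
  using assms[unfolded cbilin_commute[of x]] cbilin_axis_left[of _ 1 x] by (simp add: vec_eq_iff)

lemma scaleR_cvec: "r *\<^sub>R (x :: complex ^ 'k) = complex_of_real r *s x"
  by (simp add: vec_eq_iff complex_eq_iff)

lemma bounded_bilinear_cbilin: "bounded_bilinear (cbilin :: complex ^ 'k \<Rightarrow> complex ^ 'k::finite \<Rightarrow> complex)"
  unfolding bilinear_conv_bounded_bilinear[symmetric] bilinear_def
  by (auto intro!: linearI simp: cbilin_algebra scaleR_cvec scaleR_conv_of_real)

lemma bounded_bilinear_cvec_scale: "bounded_bilinear ((*s) :: complex \<Rightarrow> complex ^ 'k \<Rightarrow> complex ^ 'k::finite)"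
  unfolding bilinear_conv_bounded_bilinear[symmetric] bilinear_def
  by (auto intro!: linearI simp: vec_eq_iff algebra_simps)

text \<open>The uniqueness argument for Levi-Civita connections: a trilinear expression that is symmetric in
  its first two and antisymmetric in its last two arguments vanishes. It is applied to the difference of a
  connection and a flat derivative, where symmetry is the torsion condition and antisymmetry is
  compatibility with the metric.\<close>

lemma koszul_trick:
  fixes T :: "'a \<Rightarrow> 'a \<Rightarrow> 'a \<Rightarrow> complex"
  assumes sym: "\<And>x y z. Q x \<Longrightarrow> Q y \<Longrightarrow> Q z \<Longrightarrow> T x y z = T y x z"
    and anti: "\<And>x y z. Q x \<Longrightarrow> Q y \<Longrightarrow> Q z \<Longrightarrow> T x y z + T x z y = 0"
    and Q: "Q x" "Q y" "Q z"
  shows "T x y z = 0"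
proof -
  have "T x y z = - T x z y" using anti[of x y z] Q by (simp add: add_eq_0_iff)
  also have "T x z y = T z x y" by (rule sym) (use Q in auto)
  also have "T z x y = - T z y x" using anti[of z x y] Q by (simp add: add_eq_0_iff2)
  also have "T z y x = T y z x" by (rule sym) (use Q in auto)
  also have "T y z x = - T y x z" using anti[of y z x] Q by (simp add: add_eq_0_iff2)
  also have "T y x z = T x y z" by (rule sym) (use Q in auto)
  finally show ?thesis by simp
qed

text \<open>On the quadric, where \<open>\<langle>w,w\<rangle> = -1\<close>, this is the orthogonal projection of the constant vector \<open>u\<close> to the
  tangent space at \<open>w\<close>. Being polynomial, it is a global field on the ambient space.\<close>

definition proj_field :: "complex ^ 'k \<Rightarrow> complex ^ 'k \<Rightarrow> complex ^ 'k" where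
  "proj_field u w = u + cbilin u w *s w"

lemma proj_field_tangent: "z \<in> quadric \<Longrightarrow> proj_field u z \<in> quadric_tangent z"
  unfolding proj_field_def quadric_def quadric_tangent_def
  by (simp add: cbilin_algebra cbilin_commute[of u])

lemma proj_field_of_tangent: "u \<in> quadric_tangent z \<Longrightarrow> proj_field u z = u"
  unfolding proj_field_def quadric_tangent_def by (simp add: cbilin_commute[of u])

lemma proj_field_has_derivative:
  "(proj_field u has_derivative (\<lambda>h. cbilin u h *s z + cbilin u z *s h)) (at z)"
proof -
  have "(cbilin u has_derivative cbilin u) (at z)"
    by (rule bounded_linear_imp_has_derivative[OF bounded_bilinear.bounded_linear_right[OF bounded_bilinear_cbilin]])
  then have "((\<lambda>w. u + cbilin u w *s w) has_derivative (\<lambda>h. 0 + (cbilin u z *s h + cbilin u h *s z))) (at z)"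
    by (intro has_derivative_add has_derivative_const bounded_bilinear.FDERIV[OF bounded_bilinear_cvec_scale] has_derivative_ident)
  then show ?thesis unfolding proj_field_def[abs_def] by (simp add: add.commute)
qed

lemma quadric_field_near_proj_field:
  fixes z :: "complex ^ 'k::finite"
  shows "quadric_field_near z (proj_field u)"
  unfolding quadric_field_near_def
proof (intro exI[of _ UNIV] conjI ballI)
  show "Cinf_on UNIV (proj_field u)"
    unfolding proj_field_def[abs_def]
    by (intro Cinf_on_add Cinf_on_const Cinf_on_bilinear[OF _ bounded_bilinear_cvec_scale]
      Cinf_on_bounded_linear[OF _ bounded_bilinear.bounded_linear_right[OF bounded_bilinear_cbilin]] Cinf_on_id) auto
qed (auto intro: proj_field_tangent)

text \<open>The difference \<open>G\<close> of \<open>D\<close> and the flat derivative is orthogonal to all tangent vectors by Koszul's argument,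
  hence a multiple of the normal vector \<open>z\<close>. The multiple is read off from the tangency of \<open>D z u\<close>.\<close>

lemma quadric_levi_civita_proj_field:
  fixes z :: "complex ^ 'k::finite"
  assumes D: "quadric_levi_civita D" and z: "z \<in> quadric" and u: "u \<in> quadric_tangent z"
  shows "D z u (proj_field v) = cbilin v z *s u"
proof -
  let ?P = "proj_field :: complex ^ 'k \<Rightarrow> _"
  define dP where "dP = (\<lambda>v h. cbilin v h *s z + cbilin v z *s h)"
  have fd: "frechet_derivative (?P v) (at z) = dP v" for v
    unfolding dP_def by (rule frechet_derivative_eqI[OF proj_field_has_derivative])
  note qf = quadric_field_near_proj_field[of z]
  define G where "G = (\<lambda>u v. D z (?P u z) (?P v) - dP v (?P u z))"
  have torsion: "G a b = G b a" for a b
  proof -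
    have "D z (?P a z) (?P b) - D z (?P b z) (?P a) = dP b (?P a z) - dP a (?P b z)"
      using D z qf unfolding quadric_levi_civita_def fd[symmetric] by blast
    then show ?thesis unfolding G_def by (simp add: algebra_simps)
  qed
  have metric: "cbilin (G a b) (?P c z) + cbilin (G a c) (?P b z) = 0" for a b c
  proof -
    have "frechet_derivative (\<lambda>w. cbilin (?P b w) (?P c w)) (at z) (?P a z) =
        cbilin (D z (?P a z) (?P b)) (?P c z) + cbilin (?P b z) (D z (?P a z) (?P c))"
      using D z qf proj_field_tangent[OF z, of a] unfolding quadric_levi_civita_def by blast
    moreover have "frechet_derivative (\<lambda>w. cbilin (?P b w) (?P c w)) (at z) =
        (\<lambda>h. cbilin (?P b z) (dP c h) + cbilin (dP b h) (?P c z))"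
      unfolding dP_def
      by (intro frechet_derivative_eqI bounded_bilinear.FDERIV[OF bounded_bilinear_cbilin] proj_field_has_derivative)
    ultimately show ?thesis
      unfolding G_def by (simp add: cbilin_algebra cbilin_commute[of "?P b z"] algebra_simps)
  qed
  have G0: "cbilin (G a b) (?P c z) = 0" for a b c
    by (rule koszul_trick[where Q = "\<lambda>_. True" and T = "\<lambda>a b c. cbilin (G a b) (?P c z)"])
      (use torsion metric in auto)
  have Pu: "?P u z = u" by (rule proj_field_of_tangent[OF u])
  have zz: "cbilin z z = -1" and uz: "cbilin u z = 0" "cbilin z u = 0"
    using z u by (simp_all add: quadric_def quadric_tangent_def cbilin_commute[of u])
  have "D z u (?P v) \<in> quadric_tangent z"
    by (rule D[unfolded quadric_levi_civita_def quadric_connection_def, THEN conjunct1, THEN conjunct1,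
        THEN bspec, OF z, THEN spec, THEN mp, OF qf, THEN conjunct1, THEN bspec, OF u])
  then have Dz: "cbilin (D z u (?P v)) z = 0" by (simp add: quadric_tangent_def cbilin_commute)
  have Gz: "cbilin (G u v) z = cbilin v u"
    unfolding G_def dP_def Pu by (simp add: cbilin_algebra Dz zz uz)
  (* Koszul's argument was carried out on projections; moving the projection of w to the other factor
     gives a statement about all vectors, where the form is non-degenerate. *)
  have "cbilin (G u v + cbilin v u *s z) w = 0" for w
    using G0[of u v w] unfolding proj_field_def
    by (simp add: cbilin_algebra Gz cbilin_commute[of z] mult.commute)
  then have "G u v + cbilin v u *s z = 0" by (rule cbilin_nondegenerate)
  then show ?thesis unfolding G_def dP_def Pu by simp
qed

text \<open>The \<open>n + 2\<close> vectors are the rows of a square matrix with independent rows; such a matrix has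
  trivial kernel.\<close>

lemma orthogonal_to_basis_imp_zero:
  fixes F :: "'n::finite \<Rightarrow> complex ^ 'k::finite"
  assumes card: "CARD('k) = CARD('n) + 2"
    and indep: "\<And>c a b. (\<Sum>i\<in>UNIV. c i *s F i) + a *s s + b *s t = 0 \<Longrightarrow> (\<forall>i. c i = 0) \<and> a = 0 \<and> b = 0"
    and orth: "\<And>i. cbilin (F i) x = 0" "cbilin s x = 0" "cbilin t x = 0"
  shows "x = 0"
proof -
  have "card (UNIV :: 'k set) = card (UNIV :: 'n option option set)"
    using card by (simp add: card_UNIV_option)
  then obtain e :: "'k \<Rightarrow> 'n option option" where e: "bij e"
    using finite_same_card_bij[of "UNIV :: 'k set" "UNIV :: 'n option option set"] by auto
  define R where "R = (\<lambda>j. case j of None \<Rightarrow> s | Some None \<Rightarrow> t | Some (Some i) \<Rightarrow> F i)"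
  define M where "M = (\<chi> k. R (e k))"
  have sum_option: "(\<Sum>j\<in>UNIV. f j) = f None + (\<Sum>j\<in>UNIV. f (Some j))"
    for f :: "'b::finite option \<Rightarrow> complex ^ 'k"
    by (simp add: UNIV_option_conv sum.reindex)
  have "\<forall>k. c k = 0" if "(\<Sum>k\<in>UNIV. c k *s row k M) = 0" for c
  proof -
    (* Transport the coefficients from the rows of M to the index type of the three groups of vectors. *)
    define d where "d = c \<circ> inv e"
    have de: "d (e k) = c k" for k using bij_is_inj[OF e] by (simp add: d_def)
    have "(\<Sum>j\<in>UNIV. d j *s R j) = (\<Sum>k\<in>UNIV. d (e k) *s R (e k))"
      using sum.reindex_bij_betw[OF e, of "\<lambda>j. d j *s R j"] by simp
    also have "\<dots> = 0" using that by (simp add: de M_def row_def vec_nth_inverse)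
    finally have "d None *s s + (d (Some None) *s t + (\<Sum>i\<in>UNIV. d (Some (Some i)) *s F i)) = 0"
      by (simp add: sum_option R_def)
    then have "(\<forall>i. d (Some (Some i)) = 0) \<and> d None = 0 \<and> d (Some None) = 0"
      by (intro indep) (simp add: algebra_simps)
    then have "d j = 0" for j by (cases j rule: option.exhaust; metis option.exhaust)
    then show ?thesis using de by metis
  qed
  then obtain M' where "M ** M' = mat 1" using matrix_right_invertible_independent_rows[of M] by blast
  then have "M' ** M = mat 1" by (simp add: matrix_left_right_inverse)
  moreover have "M *v x = 0"
  proof -
    have "cbilin (R j) x = 0" for j using orth by (auto simp: R_def split: option.split)
    then show ?thesis by (simp add: vec_eq_iff matrix_vector_mult_def M_def cbilin_def)
  qed
  ultimately show ?thesis using matrix_left_invertible_ker[of M] by blast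
qed

section \<open>Derivatives of complex and vector-valued functions\<close>

lemma cvderiv_combination:
  "cvderiv (\<lambda>f. a * u f + b * v f) F = a *s cvderiv u F + b *s cvderiv v F"
  by (simp add: cvderiv_def cderiv_def vec_eq_iff algebra_simps)

lemma cvderiv_diff:
  "cvderiv (\<lambda>f. u f - v f) F = cvderiv u F - cvderiv v F"
  by (simp add: cvderiv_def cderiv_def vec_eq_iff algebra_simps)

lemma cvderiv_sum:
  "cvderiv (\<lambda>f. \<Sum>i\<in>I. c i * u i f) F = (\<Sum>i\<in>I. c i *s cvderiv (u i) F)"
  by (simp add: cvderiv_def cderiv_def vec_eq_iff algebra_simps sum.distrib sum_distrib_left)

context manifold
begin

lemma cderiv_add:
  assumes w: "w \<in> ctangent_space A p" and f: "smooth_near A p f" and h: "smooth_near A p h"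
  shows "cderiv w (\<lambda>q. f q + h q) = cderiv w f + cderiv w h"
  unfolding cderiv_def plus_complex.sel
    ctangentD(1)[OF w smooth_near_Re[OF f] smooth_near_Re[OF h]]
    ctangentD(1)[OF w smooth_near_Im[OF f] smooth_near_Im[OF h]]
  by (simp add: algebra_simps)

lemma cderiv_const:
  assumes w: "w \<in> ctangent_space A p"
  shows "cderiv w (\<lambda>_. c) = 0"
  by (simp add: cderiv_def ctangentD(5)[OF w])

text \<open>A complex derivation is only defined on real functions, so the product rule has to be assembled from
  the four products of real and imaginary parts.\<close>

lemma cderiv_mult:
  assumes w: "w \<in> ctangent_space A p" and f: "smooth_near A p f" and h: "smooth_near A p h"
  shows "cderiv w (\<lambda>q. f q * h q) = f p * cderiv w h + h p * cderiv w f"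
proof -
  note fr = smooth_near_Re[OF f] smooth_near_Im[OF f] and hr = smooth_near_Re[OF h] smooth_near_Im[OF h]
  have re: "w (\<lambda>q. Re (f q) * Re (h q) + (-1) * (Im (f q) * Im (h q))) =
      Re (f p) * w (\<lambda>q. Re (h q)) + Re (h p) * w (\<lambda>q. Re (f q))
      - (Im (f p) * w (\<lambda>q. Im (h q)) + Im (h p) * w (\<lambda>q. Im (f q)))"
    using ctangentD(1)[OF w smooth_near_mult[OF fr(1) hr(1)] smooth_near_mult[OF smooth_near_const[of _ "-1"] smooth_near_mult[OF fr(2) hr(2)]]]
      ctangentD(2)[OF w fr(1) hr(1)] ctangentD(2)[OF w fr(2) hr(2)]
      ctangentD(3)[OF w smooth_near_mult[OF fr(2) hr(2)], of "-1"] by simp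
  have im: "w (\<lambda>q. Re (f q) * Im (h q) + Im (f q) * Re (h q)) =
      Re (f p) * w (\<lambda>q. Im (h q)) + Im (h p) * w (\<lambda>q. Re (f q))
      + (Im (f p) * w (\<lambda>q. Re (h q)) + Re (h p) * w (\<lambda>q. Im (f q)))"
    using ctangentD(1)[OF w smooth_near_mult[OF fr(1) hr(2)] smooth_near_mult[OF fr(2) hr(1)]]
      ctangentD(2)[OF w fr(1) hr(2)] ctangentD(2)[OF w fr(2) hr(1)] by simp
  show ?thesis
    using re im unfolding cderiv_def
    by (simp add: complex_eq_iff algebra_simps)
qed

lemma cderiv_sum:
  assumes w: "w \<in> ctangent_space A p" and f: "\<And>i. i \<in> I \<Longrightarrow> smooth_near A p (f i)"
  shows "cderiv w (\<lambda>q. \<Sum>i\<in>I. f i q) = (\<Sum>i\<in>I. cderiv w (f i))"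
  using f
proof (induction I rule: infinite_finite_induct)
  case (insert i I)
  then have "cderiv w (\<lambda>q. f i q + (\<Sum>i\<in>I. f i q)) = cderiv w (f i) + cderiv w (\<lambda>q. \<Sum>i\<in>I. f i q)"
    by (intro cderiv_add[OF w] smooth_near_sum) auto
  then show ?case using insert by simp
qed (simp_all add: cderiv_const[OF w])

lemma cderiv_cong:
  assumes w: "w \<in> ctangent_space A p" and f: "smooth_near A p f" and h: "smooth_near A p h"
    and S: "open S" "p \<in> S" "\<And>q. q \<in> S \<Longrightarrow> f q = h q"
  shows "cderiv w f = cderiv w h"
proof -
  have ev: "\<forall>\<^sub>F q in nhds p. f q = h q" unfolding eventually_nhds using S by blast
  have "w (\<lambda>q. Re (f q)) = w (\<lambda>q. Re (h q))"
    by (rule ctangentD(4)[OF w smooth_near_Re[OF f] smooth_near_Re[OF h]])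
      (rule eventually_mono[OF ev], simp)
  moreover have "w (\<lambda>q. Im (f q)) = w (\<lambda>q. Im (h q))"
    by (rule ctangentD(4)[OF w smooth_near_Im[OF f] smooth_near_Im[OF h]])
      (rule eventually_mono[OF ev], simp)
  ultimately show ?thesis by (simp add: cderiv_def)
qed

lemma cvderiv_add:
  assumes w: "w \<in> ctangent_space A p" and f: "smooth_near A p f" and h: "smooth_near A p h"
  shows "cvderiv w (\<lambda>q. f q + h q) = cvderiv w f + cvderiv w h"
  using cderiv_add[OF w smooth_near_nth[OF f] smooth_near_nth[OF h]]
  by (simp add: cvderiv_def vec_eq_iff)

lemma cvderiv_scale:
  assumes w: "w \<in> ctangent_space A p" and f: "smooth_near A p f" and h: "smooth_near A p h"
  shows "cvderiv w (\<lambda>q. f q *s h q) = f p *s cvderiv w h + cderiv w f *s h p"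
  using cderiv_mult[OF w f smooth_near_nth[OF h]]
  by (simp add: cvderiv_def vec_eq_iff mult.commute)

lemma cvderiv_cong:
  assumes w: "w \<in> ctangent_space A p" and f: "smooth_near A p f" and h: "smooth_near A p h"
    and S: "open S" "p \<in> S" "\<And>q. q \<in> S \<Longrightarrow> f q = h q"
  shows "cvderiv w f = cvderiv w h"
  unfolding cvderiv_def
  by (intro vec_eq_iff[THEN iffD2] allI; simp; rule cderiv_cong[OF w smooth_near_nth[OF f] smooth_near_nth[OF h] S(1,2)])
    (simp add: S(3))

lemma cderiv_cbilin:
  assumes w: "w \<in> ctangent_space A p" and f: "smooth_near A p f" and h: "smooth_near A p h"
  shows "cderiv w (\<lambda>q. cbilin (f q) (h q)) = cbilin (cvderiv w f) (h p) + cbilin (f p) (cvderiv w h)"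
  unfolding cbilin_def
    cderiv_sum[OF w smooth_near_mult[OF smooth_near_nth[OF f] smooth_near_nth[OF h]]]
    cderiv_mult[OF w smooth_near_nth[OF f] smooth_near_nth[OF h]]
  by (simp add: cvderiv_def sum.distrib mult.commute add.commute)

lemma vector_field_on_subset: "vector_field_on A S X \<Longrightarrow> T \<subseteq> S \<Longrightarrow> vector_field_on A T X"
  unfolding vector_field_on_def by (meson subset_iff subset_trans)

lemma vector_field_onD: "vector_field_on A S X \<Longrightarrow> p \<in> S \<Longrightarrow> X p \<in> ctangent_space A p"
  unfolding vector_field_on_def by blast

lemma vector_field_on_near: "vector_field_on A S X \<Longrightarrow> open S \<Longrightarrow> p \<in> S \<Longrightarrow> vector_field_near A p X"
  unfolding vector_field_near_def by blast

lemma vector_field_nearD: "vector_field_near A p X \<Longrightarrow> X p \<in> ctangent_space A p"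
  unfolding vector_field_near_def vector_field_on_def by blast

lemma smooth_map_on_cderiv:
  assumes X: "vector_field_on A S X" and V: "open V" "V \<subseteq> S" and f: "smooth_map_on A V f"
  shows "smooth_map_on A V (\<lambda>q. cderiv (X q) f)"
proof -
  have "smooth_map_on A V (\<lambda>q. X q h)" if "smooth_map_on A V h" for h :: "'m \<Rightarrow> real"
    using X V that unfolding vector_field_on_def by blast
  then show ?thesis unfolding cderiv_def
    by (intro smooth_map_on_add[OF V(1)] smooth_map_on_mult[OF V(1)] smooth_map_on_const)
      (auto intro: smooth_map_on_Re[OF V(1) f] smooth_map_on_Im[OF V(1) f])
qed

lemma smooth_map_on_cvderiv:
  assumes "vector_field_on A S X" "open V" "V \<subseteq> S" "smooth_map_on A V f"
  shows "smooth_map_on A V (\<lambda>q. cvderiv (X q) f)"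
  unfolding cvderiv_def
  by (intro smooth_map_on_vec[OF assms(2)] smooth_map_on_cderiv[OF assms(1-3)] smooth_map_on_nth[OF assms(2,4)])

lemma smooth_near_cvderiv:
  assumes X: "vector_field_near A p X" and f: "smooth_near A p f"
  shows "smooth_near A p (\<lambda>q. cvderiv (X q) f)"
proof -
  obtain S T where "open S" "p \<in> S" "vector_field_on A S X" "open T" "p \<in> T" "smooth_map_on A T f"
    using assms unfolding smooth_near_def vector_field_near_def by auto
  then show ?thesis
    by (intro smooth_nearI[of "S \<inter> T"] smooth_map_on_cvderiv[of S]) (auto intro: smooth_map_on_subset)
qed

lemma smooth_near_field:
  fixes f :: "'m \<Rightarrow> real"
  assumes X: "vector_field_near A p X" and f: "smooth_near A p f"
  shows "smooth_near A p (\<lambda>q. X q f)"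
proof -
  obtain S T where "open S" "p \<in> S" "vector_field_on A S X" "open T" "p \<in> T" "smooth_map_on A T f"
    using assms unfolding smooth_near_def vector_field_near_def by auto
  moreover from this have "smooth_map_on A (S \<inter> T) (\<lambda>q. X q f)"
    using smooth_map_on_subset[of T f "S \<inter> T"] unfolding vector_field_on_def by blast
  ultimately show ?thesis by (intro smooth_nearI[of "S \<inter> T"]) auto
qed

lemma cderiv_lie_bracket:
  assumes X: "vector_field_near A p X" and Y: "vector_field_near A p Y" and f: "smooth_near A p f"
  shows "cderiv (lie_bracket A X Y p) f = cderiv (X p) (\<lambda>q. cderiv (Y q) f) - cderiv (Y p) (\<lambda>q. cderiv (X q) f)"
proof -
  note fr = smooth_near_Re[OF f] smooth_near_Im[OF f]
  have *: "cderiv (U p) (\<lambda>q. cderiv (V q) f) = cderiv (U p) (\<lambda>q. V q (\<lambda>q. Re (f q))) + \<i> * cderiv (U p) (\<lambda>q. V q (\<lambda>q. Im (f q)))"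
    if "vector_field_near A p U" "vector_field_near A p V" for U V
  proof -
    note u = vector_field_nearD[OF that(1)] and s = smooth_near_field[OF that(2) fr(1)] smooth_near_field[OF that(2) fr(2)]
    show ?thesis
      unfolding cderiv_def[of "V _" for V]
      using cderiv_add[OF u s(1) smooth_near_mult[OF smooth_near_const s(2)], of \<i>]
        cderiv_mult[OF u smooth_near_const s(2), of \<i>] cderiv_const[OF u, of \<i>]
      by (simp add: cderiv_def)
  qed
  show ?thesis
    unfolding *[OF X Y] *[OF Y X] cderiv_def[of "lie_bracket A X Y p"] using fr
    by (simp add: lie_bracket_def algebra_simps)
qed

text \<open>The flat space carrying \<open>f\<close> has neither torsion nor curvature. Both the Codazzi and the Gauss equation reduce to this
  identity.\<close>

lemma cvderiv_lie_bracket: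
  assumes X: "vector_field_near A p X" and Y: "vector_field_near A p Y" and f: "smooth_near A p f"
  shows "cvderiv (lie_bracket A X Y p) f = cvderiv (X p) (\<lambda>q. cvderiv (Y q) f) - cvderiv (Y p) (\<lambda>q. cvderiv (X q) f)"
  using cderiv_lie_bracket[OF X Y smooth_near_nth[OF f]] by (simp add: cvderiv_def vec_eq_iff)

end

section \<open>Immersions into the quadric\<close>

locale quadric_immersion = manifold A
  for A :: "('m::{t2_space, second_countable_topology}, 'n::finite) atlas" +
  fixes \<sigma> :: "'m \<Rightarrow> complex ^ 'k::finite"
  assumes admissible: "admissible_immersion A \<sigma>"
begin

abbreviation push :: "'m cvfield \<Rightarrow> 'm \<Rightarrow> complex ^ 'k" where
  "push Y \<equiv> \<lambda>q. cvderiv (Y q) \<sigma>"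

lemma sigma_smooth: "smooth_map_on A S \<sigma>"
  using admissible smooth_map_on_subset[of UNIV \<sigma> S] by (auto simp: admissible_immersion_def immersion_def)

lemma sigma_smooth_near: "smooth_near A p \<sigma>"
  by (rule smooth_nearI[OF open_UNIV UNIV_I sigma_smooth])

lemma sigma_quadric: "\<sigma> p \<in> quadric"
  using admissible by (auto simp: admissible_immersion_def immersion_def)

lemma sigma_sigma: "cbilin (\<sigma> p) (\<sigma> p) = - 1"
  using sigma_quadric by (simp add: quadric_def)

lemma cderiv_locally_const:
  assumes "w \<in> ctangent_space A p" "smooth_near A p f" "open S" "p \<in> S" "\<And>q. q \<in> S \<Longrightarrow> f q = c"
  shows "cderiv w f = 0"
  using cderiv_cong[OF assms(1,2) smooth_near_const assms(3,4), of c] assms(5) cderiv_const[OF assms(1)] by simp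

text \<open>Differentiating a constant product moves the derivative from one factor to the other. Applied to the
  constant products that define the quadric, tangency and the normal field, this yields all components
  along \<open>\<sigma>\<close> and \<open>\<nu>\<close>.\<close>

lemma leibniz_const:
  assumes w: "w \<in> ctangent_space A p" and f: "smooth_near A p f" and h: "smooth_near A p h"
    and S: "open S" "p \<in> S" "\<And>q. q \<in> S \<Longrightarrow> cbilin (f q) (h q) = c"
  shows "cbilin (cvderiv w f) (h p) = - cbilin (f p) (cvderiv w h)"
  using cderiv_cbilin[OF w f h]
    cderiv_locally_const[OF w smooth_near_bilinear[OF bounded_bilinear_cbilin f h] S]
  by (simp add: add_eq_0_iff2)

lemma push_sigma:
  assumes "v \<in> ctangent_space A p"
  shows "cbilin (cvderiv v \<sigma>) (\<sigma> p) = 0"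
  using leibniz_const[OF assms sigma_smooth_near sigma_smooth_near open_UNIV UNIV_I sigma_sigma]
  by (simp add: cbilin_commute)

lemma push_nondegenerate:
  assumes "u \<in> ctangent_space A p"
    and "\<And>w. w \<in> ctangent_space A p \<Longrightarrow> cbilin (cvderiv u \<sigma>) (cvderiv w \<sigma>) = 0"
  shows "u = (\<lambda>_. 0)"
proof -
  have "complex_metric A (induced_metric \<sigma>)" using admissible by (simp add: admissible_immersion_def)
  then have "\<forall>u\<in>ctangent_space A p. (\<forall>v\<in>ctangent_space A p. induced_metric \<sigma> p u v = 0) \<longrightarrow> u = (\<lambda>_. 0)"
    unfolding complex_metric_def by (elim conjE) (erule spec)
  then show ?thesis using assms by (simp add: induced_metric_def)
qed

lemma push_smooth_near: "vector_field_near A p Y \<Longrightarrow> smooth_near A p (push Y)"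
  by (rule smooth_near_cvderiv[OF _ sigma_smooth_near])

lemma push_section_on:
  assumes "vector_field_on A S Y" "open S"
  shows "pullback_section_on A \<sigma> S (push Y)"
  unfolding pullback_section_on_def quadric_tangent_def
  using smooth_map_on_cvderiv[OF assms order_refl sigma_smooth] push_sigma vector_field_onD[OF assms(1)]
  by (simp add: cbilin_commute[of "\<sigma> _"])

lemma push_section_near:
  assumes "vector_field_near A p Y"
  shows "pullback_section_near A \<sigma> p (push Y)"
  using assms push_section_on unfolding vector_field_near_def pullback_section_near_def by blast

lemma pullback_section_near_smooth: "pullback_section_near A \<sigma> p W \<Longrightarrow> smooth_near A p W"
  unfolding pullback_section_near_def pullback_section_on_def smooth_near_def by blast

lemma pullback_section_nearE:
  assumes "pullback_section_near A \<sigma> p W"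
  obtains S where "open S" "p \<in> S" "smooth_map_on A S W" "\<And>q. q \<in> S \<Longrightarrow> cbilin (\<sigma> q) (W q) = 0"
  using assms that unfolding pullback_section_near_def pullback_section_on_def quadric_tangent_def by auto

lemma pullback_section_nearI:
  assumes "open S" "p \<in> S" "smooth_map_on A S W" "\<And>q. q \<in> S \<Longrightarrow> cbilin (\<sigma> q) (W q) = 0"
  shows "pullback_section_near A \<sigma> p W"
  using assms unfolding pullback_section_near_def pullback_section_on_def quadric_tangent_def by blast

lemma section_add:
  assumes "pullback_section_near A \<sigma> p W" "pullback_section_near A \<sigma> p Z"
  shows "pullback_section_near A \<sigma> p (\<lambda>q. W q + Z q)"
proof -
  obtain S where S: "open S" "p \<in> S" "smooth_map_on A S W" "\<And>q. q \<in> S \<Longrightarrow> cbilin (\<sigma> q) (W q) = 0"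
    by (rule pullback_section_nearE[OF assms(1)], rule that)
  obtain T where T: "open T" "p \<in> T" "smooth_map_on A T Z" "\<And>q. q \<in> T \<Longrightarrow> cbilin (\<sigma> q) (Z q) = 0"
    by (rule pullback_section_nearE[OF assms(2)], rule that)
  have o: "open (S \<inter> T)" using S T by auto
  show ?thesis
    by (rule pullback_section_nearI[OF o _ smooth_map_on_add[OF o smooth_map_on_subset[OF S(3)] smooth_map_on_subset[OF T(3)]]])
      (use S T in \<open>auto simp: cbilin_algebra\<close>)
qed

lemma section_zero: "pullback_section_near A \<sigma> p (\<lambda>_. 0)"
  by (rule pullback_section_nearI[OF open_UNIV UNIV_I smooth_map_on_const]) (simp add: cbilin_algebra)

lemma section_sum:
  assumes "\<And>i. i \<in> I \<Longrightarrow> pullback_section_near A \<sigma> p (W i)"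
  shows "pullback_section_near A \<sigma> p (\<lambda>q. \<Sum>i\<in>I. W i q)"
  using assms
proof (induction I rule: infinite_finite_induct)
  case (insert i I)
  then have "pullback_section_near A \<sigma> p (\<lambda>q. W i q + (\<Sum>i\<in>I. W i q))" by (intro section_add) auto
  then show ?case using insert by simp
qed (simp_all add: section_zero)

lemma section_scaleR:
  fixes h :: "'m \<Rightarrow> real"
  assumes "pullback_section_near A \<sigma> p W" "smooth_near A p h"
  shows "pullback_section_near A \<sigma> p (\<lambda>q. h q *\<^sub>R W q)"
proof -
  obtain S where S: "open S" "p \<in> S" "smooth_map_on A S W" "\<And>q. q \<in> S \<Longrightarrow> cbilin (\<sigma> q) (W q) = 0"
    by (rule pullback_section_nearE[OF assms(1)], rule that)
  obtain T where T: "open T" "p \<in> T" "smooth_map_on A T h"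
    using assms(2) unfolding smooth_near_def by auto
  have o: "open (S \<inter> T)" using S T by auto
  show ?thesis
    by (rule pullback_section_nearI[OF o _ smooth_map_on_bilinear[OF o bounded_bilinear_scaleR smooth_map_on_subset[OF T(3)] smooth_map_on_subset[OF S(3)]]])
      (use S T in \<open>auto simp: cbilin_algebra scaleR_cvec\<close>)
qed

lemma section_proj_field: "pullback_section_near A \<sigma> p (\<lambda>q. proj_field u (\<sigma> q))"
proof (rule pullback_section_nearI[OF open_UNIV UNIV_I])
  show "smooth_map_on A UNIV (\<lambda>q. proj_field u (\<sigma> q))"
    unfolding proj_field_def
    by (intro smooth_map_on_add smooth_map_on_const smooth_map_on_bilinear[OF _ bounded_bilinear_cvec_scale]
        smooth_map_on_bilinear[OF _ bounded_bilinear_cbilin] sigma_smooth open_UNIV)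
  show "cbilin (\<sigma> q) (proj_field u (\<sigma> q)) = 0" for q
    using proj_field_tangent[OF sigma_quadric[of q]] by (simp add: quadric_tangent_def)
qed

end

section \<open>The pulled back connection\<close>

locale quadric_immersion_connection = quadric_immersion A \<sigma>
  for A :: "('m::{t2_space, second_countable_topology}, 'n::finite) atlas"
    and \<sigma> :: "'m \<Rightarrow> complex ^ 'k::finite" +
  fixes D :: "'k qconnection" and B :: "('m, 'k) pconnection"
  assumes D: "quadric_levi_civita D" and B: "pullback_connection A \<sigma> D B"
begin

lemma B_linear:
  assumes "pullback_section_near A \<sigma> p W" "u \<in> ctangent_space A p" "v \<in> ctangent_space A p"
  shows "B p (\<lambda>f. a * u f + b * v f) W = a *s B p u W + b *s B p v W"
  using B[unfolded pullback_connection_def, THEN conjunct1] assms by blast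

lemma B_add:
  assumes "pullback_section_near A \<sigma> p W" "pullback_section_near A \<sigma> p Z" "v \<in> ctangent_space A p"
  shows "B p v (\<lambda>q. W q + Z q) = B p v W + B p v Z"
  using B[unfolded pullback_connection_def, THEN conjunct2, THEN conjunct1] assms by blast

lemma B_cong:
  assumes "pullback_section_near A \<sigma> p W" "pullback_section_near A \<sigma> p Z" "v \<in> ctangent_space A p"
    "\<forall>\<^sub>F q in nhds p. W q = Z q"
  shows "B p v W = B p v Z"
  using B[unfolded pullback_connection_def, THEN conjunct2, THEN conjunct1] assms by blast

lemma B_leibniz:
  assumes "pullback_section_near A \<sigma> p W" "smooth_near A p h" "v \<in> ctangent_space A p"
  shows "B p v (\<lambda>q. h q *\<^sub>R W q) = v h *s W p + h p *\<^sub>R B p v W"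
  using B[unfolded pullback_connection_def, THEN conjunct2, THEN conjunct2, THEN conjunct1] assms by blast

lemma B_pullback:
  assumes "quadric_field_near (\<sigma> p) Y" "v \<in> tangent_space A p"
  shows "B p (complexify v) (\<lambda>q. Y (\<sigma> q)) = D (\<sigma> p) (cvderiv (complexify v) \<sigma>) Y"
  using B[unfolded pullback_connection_def, THEN conjunct2, THEN conjunct2, THEN conjunct2, THEN conjunct2] assms by blast

lemma B_sum:
  assumes "\<And>i. i \<in> I \<Longrightarrow> pullback_section_near A \<sigma> p (W i)" and v: "v \<in> ctangent_space A p"
  shows "B p v (\<lambda>q. \<Sum>i\<in>I. W i q) = (\<Sum>i\<in>I. B p v (W i))"
proof -
  have zero: "B p v (\<lambda>_. 0) = 0" using B_add[OF section_zero section_zero v] by simp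
  show ?thesis using assms(1)
  proof (induction I rule: infinite_finite_induct)
    case (insert i I)
    then have "B p v (\<lambda>q. W i q + (\<Sum>i\<in>I. W i q)) = B p v (W i) + B p v (\<lambda>q. \<Sum>i\<in>I. W i q)"
      by (intro B_add section_sum v) auto
    then show ?case using insert by simp
  qed (simp_all add: zero)
qed

text \<open>On a real vector, \<open>B\<close> is \<open>D\<close> applied to the spanning field. A complex vector splits into its real
  and imaginary part.\<close>

lemma B_proj_field:
  assumes v: "v \<in> ctangent_space A p"
  shows "B p v (\<lambda>q. proj_field u (\<sigma> q)) = cbilin u (\<sigma> p) *s cvderiv v \<sigma>"
proof -
  have real: "B p (complexify r) (\<lambda>q. proj_field u (\<sigma> q)) = cbilin u (\<sigma> p) *s cvderiv (complexify r) \<sigma>"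
    if r: "r \<in> tangent_space A p" for r
    unfolding B_pullback[OF quadric_field_near_proj_field r]
    by (rule quadric_levi_civita_proj_field[OF D sigma_quadric])
      (use push_sigma[OF complexify_ctangent[OF r]] in \<open>simp add: quadric_tangent_def cbilin_commute\<close>)
  define r i where "r = (\<lambda>f. Re (v f))" and "i = (\<lambda>f. Im (v f))"
  have ri: "r \<in> tangent_space A p" "i \<in> tangent_space A p"
    using v by (simp_all add: ctangent_space_def r_def i_def)
  have "v = (\<lambda>f. 1 * complexify r f + \<i> * complexify i f)"
    by (auto simp: r_def i_def complexify_def complex_eq_iff)
  then show ?thesis
    using B_linear[OF section_proj_field complexify_ctangent[OF ri(1)] complexify_ctangent[OF ri(2)], of 1 \<i> u]
      cvderiv_combination[of 1 "complexify r" \<i> "complexify i" \<sigma>]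
    by (simp add: real ri vec_eq_iff algebra_simps)
qed

text \<open>A section \<open>W\<close> is expanded in the standard basis of \<open>\<complex>\<^sup>k\<close>. Since \<open>W\<close> is tangent to the quadric, the basis
  vectors may be replaced by their projections, the fields \<open>proj_field\<close>, on which \<open>B\<close> is known. As \<open>B\<close> obeys
  the product rule for real functions, real and imaginary parts of the coefficients are treated
  separately, the latter with the fields of \<open>axis k \<i>\<close>.\<close>

lemma B_eq:
  assumes W: "pullback_section_near A \<sigma> p W" and v: "v \<in> ctangent_space A p"
  shows "B p v W = cvderiv v W + cbilin (cvderiv v W) (\<sigma> p) *s \<sigma> p"
proof -
  define P where "P = (\<lambda>k a q. proj_field (axis k a) (\<sigma> q))"
  have P: "P k a q = axis k a + (a * \<sigma> q $ k) *s \<sigma> q" for k a q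
    unfolding P_def proj_field_def by (simp add: cbilin_axis_left)
  have secP: "pullback_section_near A \<sigma> p (P k a)" for k a
    unfolding P_def by (rule section_proj_field)
  have BP: "B p v (P k a) = (a * \<sigma> p $ k) *s cvderiv v \<sigma>" for k a
    unfolding P_def B_proj_field[OF v] by (simp add: cbilin_axis_left)
  have smW: "smooth_near A p W" by (rule pullback_section_near_smooth[OF W])
  note re = smooth_near_Re[OF smooth_near_nth[OF smW]] and im = smooth_near_Im[OF smooth_near_nth[OF smW]]
  (* The real and imaginary part of the k-th coefficient of W, each with its own projected basis vector. *)
  define Q where "Q = (\<lambda>k q. Re (W q $ k) *\<^sub>R P k 1 q + Im (W q $ k) *\<^sub>R P k \<i> q)"
  have Q: "Q k q = axis k (W q $ k) + (W q $ k * \<sigma> q $ k) *s \<sigma> q" for k q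
    unfolding Q_def P by (auto simp: vec_eq_iff axis_def complex_eq_iff algebra_simps)
  have secQ: "pullback_section_near A \<sigma> p (Q k)" for k
    unfolding Q_def by (intro section_add section_scaleR secP re im)
  have sum_axis: "(\<Sum>k\<in>UNIV. axis k (x $ k)) = x" for x :: "complex ^ 'k"
    by (simp add: vec_eq_iff axis_def)
  have sum_Q: "(\<Sum>k\<in>UNIV. Q k q) = W q + cbilin (W q) (\<sigma> q) *s \<sigma> q" for q
    unfolding Q sum.distrib sum_axis cbilin_def
    by (simp add: vec_eq_iff sum_distrib_right)
  obtain S where S: "open S" "p \<in> S" "\<And>q. q \<in> S \<Longrightarrow> cbilin (\<sigma> q) (W q) = 0"
    using pullback_section_nearE[OF W] by metis
  have "\<forall>\<^sub>F q in nhds p. W q = (\<Sum>k\<in>UNIV. Q k q)"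
    unfolding eventually_nhds
    by (intro exI[of _ S] conjI S ballI) (simp add: sum_Q S(3) cbilin_commute[of "W _"])
  then have "B p v W = B p v (\<lambda>q. \<Sum>k\<in>UNIV. Q k q)"
    by (intro B_cong W section_sum secQ v)
  also have "\<dots> = (\<Sum>k\<in>UNIV. B p v (Q k))"
    by (rule B_sum[OF secQ v])
  also have "\<dots> = (\<Sum>k\<in>UNIV. axis k (cvderiv v W $ k) + (cvderiv v W $ k * \<sigma> p $ k) *s \<sigma> p + (W p $ k * \<sigma> p $ k) *s cvderiv v \<sigma>)"
  proof (rule sum.cong[OF refl])
    fix k
    have "B p v (Q k) = (v (\<lambda>q. Re (W q $ k)) *s P k 1 p + Re (W p $ k) *\<^sub>R B p v (P k 1))
        + (v (\<lambda>q. Im (W q $ k)) *s P k \<i> p + Im (W p $ k) *\<^sub>R B p v (P k \<i>))"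
      unfolding Q_def
      by (simp only: B_add[OF section_scaleR[OF secP re] section_scaleR[OF secP im] v] B_leibniz[OF secP re v] B_leibniz[OF secP im v])
    also have "\<dots> = axis k (cvderiv v W $ k) + (cvderiv v W $ k * \<sigma> p $ k) *s \<sigma> p + (W p $ k * \<sigma> p $ k) *s cvderiv v \<sigma>"
      unfolding BP P cvderiv_def[of v W] cderiv_def scaleR_cvec
      by (subst complex_eq[of "W p $ k"]) (auto simp: vec_eq_iff axis_def algebra_simps)
    finally show "B p v (Q k) = axis k (cvderiv v W $ k) + (cvderiv v W $ k * \<sigma> p $ k) *s \<sigma> p + (W p $ k * \<sigma> p $ k) *s cvderiv v \<sigma>" .
  qed
  also have "\<dots> = cvderiv v W + cbilin (cvderiv v W) (\<sigma> p) *s \<sigma> p + cbilin (W p) (\<sigma> p) *s cvderiv v \<sigma>"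
    unfolding sum.distrib sum_axis cbilin_def
    by (simp add: vec_eq_iff sum_distrib_right)
  also have "cbilin (W p) (\<sigma> p) = 0" using S by (simp add: cbilin_commute)
  finally show ?thesis by simp
qed

end

section \<open>The equations of Weingarten, Codazzi and Gauss\<close>

locale immersed_hypersurface = quadric_immersion_connection A \<sigma> D B
  for A :: "('m::{t2_space, second_countable_topology}, 'n::finite) atlas"
    and \<sigma> :: "'m \<Rightarrow> complex ^ 'k::finite"
    and D :: "'k qconnection" and B :: "('m, 'k) pconnection" +
  fixes N :: "'m connection" and \<nu> :: "'m \<Rightarrow> complex ^ 'k" and \<Psi> :: "'m \<Rightarrow> 'm ctvec \<Rightarrow> 'm ctvec"
    and W :: "'m set"
  assumes dim: "CARD('k) = CARD('n) + 2"
    and N: "levi_civita A (induced_metric \<sigma>) N"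
    and open_W: "open W"
    and \<nu>: "normal_field_on A \<sigma> W \<nu>"
    and \<Psi>: "shape_operator_on A \<sigma> B \<nu> W \<Psi>"
begin

lemma N_tangent:
  assumes "vector_field_near A p Y" "v \<in> ctangent_space A p"
  shows "N p v Y \<in> ctangent_space A p"
  using N[unfolded levi_civita_def is_connection_def, THEN conjunct1, THEN conjunct1] assms by blast

lemma N_field:
  assumes "open S" "vector_field_on A S X" "vector_field_on A S Y"
  shows "vector_field_on A S (\<lambda>p. N p (X p) Y)"
  using N[unfolded levi_civita_def is_connection_def, THEN conjunct1, THEN conjunct2, THEN conjunct2, THEN conjunct2] assms
  by blast

lemma N_torsion_free:
  assumes "vector_field_near A p X" "vector_field_near A p Y"
  shows "lie_bracket A X Y p = (\<lambda>f. N p (X p) Y f - N p (Y p) X f)"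
  using N[unfolded levi_civita_def, THEN conjunct2, THEN conjunct1] assms by metis

lemma N_metric:
  assumes "vector_field_near A p X" "vector_field_near A p Y" "v \<in> ctangent_space A p"
  shows "cderiv v (\<lambda>q. cbilin (push X q) (push Y q)) =
    cbilin (cvderiv (N p v X) \<sigma>) (push Y p) + cbilin (push X p) (cvderiv (N p v Y) \<sigma>)"
  using N[unfolded levi_civita_def, THEN conjunct2, THEN conjunct2] assms unfolding induced_metric_def by blast

lemma ctangent_diff:
  assumes "u \<in> ctangent_space A p" "v \<in> ctangent_space A p"
  shows "(\<lambda>f. u f - v f) \<in> ctangent_space A p"
  using ctangent_combination[OF assms, of 1 "-1"] by simp

lemma lie_bracket_tangent:
  assumes "vector_field_near A p X" "vector_field_near A p Y"
  shows "lie_bracket A X Y p \<in> ctangent_space A p"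
  unfolding N_torsion_free[OF assms]
  by (intro ctangent_diff N_tangent assms vector_field_nearD)

text \<open>The push-forward of \<open>\<nabla>\<^sub>v Y\<close> and the flat derivative of \<open>push Y\<close> have the same tangential part. Koszul's
  argument needs fields in all three slots, which is why \<open>v\<close> and \<open>w\<close> are extended first.\<close>

lemma levi_civita_push:
  assumes Y: "vector_field_near A p Y" and v: "v \<in> ctangent_space A p" and w: "w \<in> ctangent_space A p"
  shows "cbilin (cvderiv (N p v Y) \<sigma>) (cvderiv w \<sigma>) = cbilin (cvderiv v (push Y)) (cvderiv w \<sigma>)"
proof -
  (* Koszul's trilinear expression for the difference of the two connections. *)
  define T where "T = (\<lambda>X Y Z. cbilin (cvderiv (N p (X p) Y) \<sigma> - cvderiv (X p) (push Y)) (push Z p))"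
  obtain X where X: "vector_field_near A p X" "X p = v" using ctangent_extend[OF v] .
  obtain Z where Z: "vector_field_near A p Z" "Z p = w" using ctangent_extend[OF w] .
  have "T X Y Z = 0"
  proof (rule koszul_trick[where Q = "vector_field_near A p" and T = T])
    fix X Y Z assume X: "vector_field_near A p X" and Y: "vector_field_near A p Y" and Z: "vector_field_near A p Z"
    have "cvderiv (N p (X p) Y) \<sigma> - cvderiv (N p (Y p) X) \<sigma> = cvderiv (X p) (push Y) - cvderiv (Y p) (push X)"
      using cvderiv_lie_bracket[OF X Y sigma_smooth_near]
      unfolding N_torsion_free[OF X Y] cvderiv_diff .
    then have "cvderiv (N p (X p) Y) \<sigma> - cvderiv (X p) (push Y) = cvderiv (N p (Y p) X) \<sigma> - cvderiv (Y p) (push X)"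
      by (simp add: algebra_simps)
    then show "T X Y Z = T Y X Z" unfolding T_def by simp
    show "T X Y Z + T X Z Y = 0"
      using N_metric[OF Y Z vector_field_nearD[OF X]]
        cderiv_cbilin[OF vector_field_nearD[OF X] push_smooth_near[OF Y] push_smooth_near[OF Z]]
      unfolding T_def cbilin_diff_left by (simp add: cbilin_commute[of "push Y p"] algebra_simps)
  qed (fact X Y Z)+
  then show ?thesis by (simp add: T_def X Z cbilin_algebra)
qed

lemma nu_smooth: "smooth_map_on A W \<nu>"
  using \<nu> by (simp add: normal_field_on_def pullback_section_on_def)

lemma nu_sigma: "p \<in> W \<Longrightarrow> cbilin (\<nu> p) (\<sigma> p) = 0"
  using \<nu> unfolding cbilin_commute[of "\<nu> p"]
  by (simp add: normal_field_on_def pullback_section_on_def quadric_tangent_def)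

lemma nu_nu: "p \<in> W \<Longrightarrow> cbilin (\<nu> p) (\<nu> p) = 1"
  using \<nu> by (simp add: normal_field_on_def)

lemma push_nu: "p \<in> W \<Longrightarrow> v \<in> ctangent_space A p \<Longrightarrow> cbilin (cvderiv v \<sigma>) (\<nu> p) = 0"
  using \<nu> by (simp add: normal_field_on_def)

lemma nu_smooth_near: "p \<in> W \<Longrightarrow> smooth_near A p \<nu>"
  by (rule smooth_nearI[OF open_W _ nu_smooth])

lemma Psi_tangent: "p \<in> W \<Longrightarrow> v \<in> ctangent_space A p \<Longrightarrow> \<Psi> p v \<in> ctangent_space A p"
  using \<Psi>[unfolded shape_operator_on_def endomorphism_on_def, THEN conjunct1, THEN conjunct1] by blast

lemma Psi_field:
  assumes "open V" "V \<subseteq> W" "vector_field_on A V X"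
  shows "vector_field_on A V (\<lambda>p. \<Psi> p (X p))"
  using \<Psi>[unfolded shape_operator_on_def endomorphism_on_def, THEN conjunct1, THEN conjunct2, THEN conjunct2] assms
  by blast

text \<open>The defining property of \<open>\<Psi>\<close> with the flat derivative in place of \<open>B\<close>: they differ by a multiple of
  \<open>\<sigma>\<close>, to which \<open>\<nu>\<close> is orthogonal.\<close>

lemma Psi_metric:
  assumes p: "p \<in> W" and v: "v \<in> ctangent_space A p" and Y: "vector_field_near A p Y"
  shows "cbilin (cvderiv (\<Psi> p v) \<sigma>) (push Y p) = - cbilin (cvderiv v (push Y)) (\<nu> p)"
proof -
  have "cbilin (cvderiv (\<Psi> p v) \<sigma>) (push Y p) = - cbilin (B p v (push Y)) (\<nu> p)"
    by (rule \<Psi>[unfolded shape_operator_on_def induced_metric_def, THEN conjunct2, THEN bspec, OF p,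
        THEN bspec, OF v, THEN spec, THEN mp, OF Y])
  then show ?thesis
    unfolding B_eq[OF push_section_near[OF Y] v]
    by (simp add: cbilin_algebra nu_sigma[OF p] cbilin_commute[of "\<sigma> p"])
qed

text \<open>The images of independent tangent vectors, together with \<open>\<sigma> p\<close> and \<open>\<nu> p\<close>, are \<open>n + 2\<close> independent vectors of
  \<open>\<complex>\<^sup>k\<close>: \<open>\<sigma> p\<close> and \<open>\<nu> p\<close> are orthogonal to each other and to the tangent image and not isotropic, and
  the differential is injective on \<open>\<complex>T\<^sub>pM\<close> because the induced metric is non-degenerate.\<close>

lemma orthogonal_to_frame_imp_zero:
  assumes p: "p \<in> W"
    and tan: "\<And>w. w \<in> ctangent_space A p \<Longrightarrow> cbilin (cvderiv w \<sigma>) x = 0"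
    and sig: "cbilin (\<sigma> p) x = 0" and nor: "cbilin (\<nu> p) x = 0"
  shows "x = 0"
proof -
  obtain E :: "'n \<Rightarrow> 'm ctvec" where E: "\<And>i. E i \<in> ctangent_space A p"
    "\<And>c i. (\<lambda>f. \<Sum>i\<in>UNIV. c i * E i f) = (\<lambda>_. 0) \<Longrightarrow> c i = 0"
    by (rule ctangent_independent, rule that)
  show ?thesis
  proof (rule orthogonal_to_basis_imp_zero[OF dim, of "\<lambda>i. cvderiv (E i) \<sigma>" "\<sigma> p" "\<nu> p"])
    fix c a b
    assume 0: "(\<Sum>i\<in>UNIV. c i *s cvderiv (E i) \<sigma>) + a *s \<sigma> p + b *s \<nu> p = 0"
    let ?u = "\<lambda>f. \<Sum>i\<in>UNIV. c i * E i f"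
    have u: "?u \<in> ctangent_space A p" by (rule ctangent_sum[OF E(1)])
    have 1: "cvderiv ?u \<sigma> + a *s \<sigma> p + b *s \<nu> p = 0" using 0 by (simp add: cvderiv_sum)
    have a: "a = 0"
      using arg_cong[OF 1, of "\<lambda>y. cbilin y (\<sigma> p)"]
      by (simp add: cbilin_algebra push_sigma[OF u] sigma_sigma nu_sigma[OF p])
    have b: "b = 0"
      using arg_cong[OF 1, of "\<lambda>y. cbilin y (\<nu> p)"] a
      by (simp add: cbilin_algebra push_nu[OF p u] nu_nu[OF p])
    have "?u = (\<lambda>_. 0)"
      by (rule push_nondegenerate[OF u]) (use 1 a b in \<open>simp add: cbilin_algebra\<close>)
    then show "(\<forall>i. c i = 0) \<and> a = 0 \<and> b = 0" using E(2)[of c] a b by blast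
  qed (use tan sig nor E(1) in auto)
qed

text \<open>The Weingarten equation. Both sides are orthogonal to \<open>\<sigma> p\<close> and \<open>\<nu> p\<close>, and they have the same products with
  tangent vectors because \<open>\<langle>push Y,\<nu>\<rangle>\<close> vanishes identically.\<close>

lemma push_Psi:
  assumes p: "p \<in> W" and v: "v \<in> ctangent_space A p"
  shows "cvderiv (\<Psi> p v) \<sigma> = cvderiv v \<nu>"
proof -
  note \<Psi>v = Psi_tangent[OF p v] and sn = nu_smooth_near[OF p]
  have "cvderiv (\<Psi> p v) \<sigma> - cvderiv v \<nu> = 0"
  proof (rule orthogonal_to_frame_imp_zero[OF p])
    show "cbilin (\<sigma> p) (cvderiv (\<Psi> p v) \<sigma> - cvderiv v \<nu>) = 0"
      using leibniz_const[OF v sigma_smooth_near sn open_W p, of 0] push_sigma[OF \<Psi>v] push_nu[OF p v] nu_sigma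
      by (simp add: cbilin_algebra cbilin_commute)
    show "cbilin (\<nu> p) (cvderiv (\<Psi> p v) \<sigma> - cvderiv v \<nu>) = 0"
      using leibniz_const[OF v sn sn open_W p nu_nu] push_nu[OF p \<Psi>v]
      by (simp add: cbilin_algebra cbilin_commute)
    fix w assume w: "w \<in> ctangent_space A p"
    obtain Y where Y: "vector_field_near A p Y" "Y p = w" using ctangent_extend[OF w] .
    then obtain S where S: "open S" "p \<in> S" "vector_field_on A S Y" unfolding vector_field_near_def by auto
    have "cbilin (cvderiv v (push Y)) (\<nu> p) = - cbilin (push Y p) (cvderiv v \<nu>)"
      by (rule leibniz_const[OF v push_smooth_near[OF Y(1)] sn, of "S \<inter> W" 0])
        (use S open_W p push_nu vector_field_onD[OF S(3)] in auto)
    then show "cbilin (cvderiv w \<sigma>) (cvderiv (\<Psi> p v) \<sigma> - cvderiv v \<nu>) = 0"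
      using Psi_metric[OF p v Y(1)] Y(2) by (simp add: cbilin_algebra cbilin_commute)
  qed
  then show ?thesis by simp
qed

text \<open>The antisymmetric part of the second fundamental form is the product of \<open>\<nu>\<close> with a push-forward, that of the
  Lie bracket.\<close>

lemma Psi_symmetric:
  assumes p: "p \<in> W" and u: "u \<in> ctangent_space A p" and v: "v \<in> ctangent_space A p"
  shows "cbilin (cvderiv (\<Psi> p u) \<sigma>) (cvderiv v \<sigma>) = cbilin (cvderiv (\<Psi> p v) \<sigma>) (cvderiv u \<sigma>)"
proof -
  obtain X where X: "vector_field_near A p X" "X p = u" using ctangent_extend[OF u] .
  obtain Y where Y: "vector_field_near A p Y" "Y p = v" using ctangent_extend[OF v] .
  have "cbilin (cvderiv u (push Y)) (\<nu> p) - cbilin (cvderiv v (push X)) (\<nu> p) = cbilin (cvderiv (lie_bracket A X Y p) \<sigma>) (\<nu> p)"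
    using cvderiv_lie_bracket[OF X(1) Y(1) sigma_smooth_near] X Y by (simp add: cbilin_algebra)
  also have "\<dots> = 0" by (rule push_nu[OF p lie_bracket_tangent[OF X(1) Y(1)]])
  finally show ?thesis using Psi_metric[OF p u Y(1)] Psi_metric[OF p v X(1)] X Y by simp
qed

text \<open>The decomposition of the flat derivative of \<open>push Y\<close> into its tangential part and its components along \<open>\<sigma>\<close>
  and \<open>\<nu>\<close>. The signs reflect \<open>\<langle>\<sigma>,\<sigma>\<rangle> = -1\<close> and \<open>\<langle>\<nu>,\<nu>\<rangle> = 1\<close>.\<close>

lemma gauss_formula:
  assumes p: "p \<in> W" and v: "v \<in> ctangent_space A p" and Y: "vector_field_near A p Y"
  shows "cvderiv (N p v Y) \<sigma> = cvderiv v (push Y)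
    + (- cbilin (cvderiv v \<sigma>) (push Y p)) *s \<sigma> p + cbilin (cvderiv (\<Psi> p v) \<sigma>) (push Y p) *s \<nu> p"
proof -
  obtain S where S: "open S" "p \<in> S" "vector_field_on A S Y" using Y unfolding vector_field_near_def by auto
  note Nv = N_tangent[OF Y v] and sY = push_smooth_near[OF Y]
  let ?R = "cvderiv v (push Y) + (- cbilin (cvderiv v \<sigma>) (push Y p)) *s \<sigma> p + cbilin (cvderiv (\<Psi> p v) \<sigma>) (push Y p) *s \<nu> p"
  have dsig: "cbilin (cvderiv v (push Y)) (\<sigma> p) = - cbilin (push Y p) (cvderiv v \<sigma>)"
    by (rule leibniz_const[OF v sY sigma_smooth_near S(1,2) push_sigma[OF vector_field_onD[OF S(3)]]])
  have "cvderiv (N p v Y) \<sigma> - ?R = 0"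
  proof (rule orthogonal_to_frame_imp_zero[OF p])
    fix w assume w: "w \<in> ctangent_space A p"
    show "cbilin (cvderiv w \<sigma>) (cvderiv (N p v Y) \<sigma> - ?R) = 0"
      using levi_civita_push[OF Y v w]
      by (simp add: cbilin_algebra push_sigma[OF w] push_nu[OF p w] cbilin_commute[of "cvderiv w \<sigma>" "cvderiv _ _"])
  next
    show "cbilin (\<sigma> p) (cvderiv (N p v Y) \<sigma> - ?R) = 0"
      using push_sigma[OF Nv] dsig nu_sigma[OF p]
      by (simp add: cbilin_algebra sigma_sigma cbilin_commute)
  next
    show "cbilin (\<nu> p) (cvderiv (N p v Y) \<sigma> - ?R) = 0"
      using push_nu[OF p Nv] nu_sigma[OF p] Psi_metric[OF p v Y]
      by (simp add: cbilin_algebra nu_nu[OF p] cbilin_commute)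
  qed
  then show ?thesis by simp
qed

text \<open>By the Weingarten equation the push-forward of \<open>d\<^sup>\<nabla>\<Psi>(Y,Z)\<close> has the tangential part of
  \<open>Y(Z \<nu>) - Z(Y \<nu>) - [Y,Z] \<nu>\<close>, which is zero.\<close>

lemma codazzi:
  assumes V: "open V" "V \<subseteq> W" and Y: "vector_field_on A V Y" and Z: "vector_field_on A V Z" and p: "p \<in> V"
  shows "d_nabla A N \<Psi> Y Z p = (\<lambda>_. 0)"
proof (rule push_nondegenerate)
  have pW: "p \<in> W" using V p by auto
  note near = vector_field_on_near[OF _ V(1) p]
  note Yn = near[OF Y] and Zn = near[OF Z]
  note lt = lie_bracket_tangent[OF Yn Zn]
  have \<Psi>n: "vector_field_near A p (\<lambda>q. \<Psi> q (X q))" if "vector_field_on A V X" for X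
    by (rule near[OF Psi_field[OF V that]])
  note NY = N_tangent[OF \<Psi>n[OF Z] vector_field_nearD[OF Yn]] and NZ = N_tangent[OF \<Psi>n[OF Y] vector_field_nearD[OF Zn]]
  show "d_nabla A N \<Psi> Y Z p \<in> ctangent_space A p"
    unfolding d_nabla_def by (intro ctangent_diff NY NZ Psi_tangent[OF pW lt])
  fix w assume w: "w \<in> ctangent_space A p"
  have push\<Psi>: "cvderiv v (push (\<lambda>q. \<Psi> q (X q))) = cvderiv v (\<lambda>q. cvderiv (X q) \<nu>)"
    if "v \<in> ctangent_space A p" "vector_field_on A V X" for v X
    by (rule cvderiv_cong[OF that(1) push_smooth_near[OF \<Psi>n[OF that(2)]]
          smooth_near_cvderiv[OF near[OF that(2)] nu_smooth_near[OF pW]] V(1) p])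
      (use V(2) push_Psi vector_field_onD[OF that(2)] in auto)
  show "cbilin (cvderiv (d_nabla A N \<Psi> Y Z p) \<sigma>) (cvderiv w \<sigma>) = 0"
    unfolding d_nabla_def cvderiv_diff cbilin_diff_left
      levi_civita_push[OF \<Psi>n[OF Z] vector_field_nearD[OF Yn] w] levi_civita_push[OF \<Psi>n[OF Y] vector_field_nearD[OF Zn] w]
      push\<Psi>[OF vector_field_nearD[OF Yn] Z] push\<Psi>[OF vector_field_nearD[OF Zn] Y]
      push_Psi[OF pW lt] cvderiv_lie_bracket[OF Yn Zn nu_smooth_near[OF pW]]
    by simp
qed

text \<open>Differentiate the Gauss formula for \<open>\<nabla>\<^sub>Y Z\<close> once more and take the product with a tangent vector. The terms
  in which a coefficient is differentiated are multiples of \<open>\<sigma>\<close> and \<open>\<nu>\<close> and drop out, while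
  differentiating \<open>\<sigma>\<close> and \<open>\<nu>\<close> themselves gives \<open>\<sigma>\<^sub>*X\<close> and \<open>\<sigma>\<^sub>*(\<Psi> X)\<close>.\<close>

lemma second_derivative_push:
  assumes V: "open V" "V \<subseteq> W" and X: "vector_field_on A V X" and Y: "vector_field_on A V Y"
    and Z: "vector_field_on A V Z" and p: "p \<in> V" and w: "w \<in> ctangent_space A p"
  shows "cbilin (cvderiv (N p (X p) (\<lambda>q. N q (Y q) Z)) \<sigma>) (cvderiv w \<sigma>) =
    cbilin (cvderiv (X p) (\<lambda>q. cvderiv (Y q) (push Z))) (cvderiv w \<sigma>)
    - cbilin (push Y p) (push Z p) * cbilin (push X p) (cvderiv w \<sigma>)
    + cbilin (cvderiv (\<Psi> p (Y p)) \<sigma>) (push Z p) * cbilin (cvderiv (\<Psi> p (X p)) \<sigma>) (cvderiv w \<sigma>)"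
proof -
  have pW: "p \<in> W" using V p by auto
  note near = vector_field_on_near[OF _ V(1) p]
  note Xp = vector_field_onD[OF X p] and Yn = near[OF Y] and Zn = near[OF Z]
  note NYZ = near[OF N_field[OF V(1) Y Z]] and \<Psi>Y = near[OF Psi_field[OF V Y]]
  note sc = smooth_near_bilinear[OF bounded_bilinear_cbilin] and sv = smooth_near_bilinear[OF bounded_bilinear_cvec_scale]
  (* The tangential part, and the coefficients of \<sigma> and \<nu>, in the Gauss formula for Y and Z. *)
  define a where "a = (\<lambda>q. (-1) * cbilin (push Y q) (push Z q))"
  define b where "b = (\<lambda>q. cbilin (push (\<lambda>q. \<Psi> q (Y q)) q) (push Z q))"
  define d where "d = (\<lambda>q. cvderiv (Y q) (push Z))"
  have sa: "smooth_near A p a" unfolding a_def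
    by (intro smooth_near_mult smooth_near_const sc push_smooth_near Yn Zn)
  have sb: "smooth_near A p b" unfolding b_def
    by (intro sc push_smooth_near \<Psi>Y Zn)
  have sd: "smooth_near A p d" unfolding d_def
    by (intro smooth_near_cvderiv Yn push_smooth_near Zn)
  note s\<sigma> = sv[OF sa sigma_smooth_near] and s\<nu> = sv[OF sb nu_smooth_near[OF pW]]
  have "push (\<lambda>q. N q (Y q) Z) q = d q + a q *s \<sigma> q + b q *s \<nu> q" if "q \<in> V" for q
    using gauss_formula[of q "Y q" Z] that V vector_field_onD[OF Y that] vector_field_on_near[OF Z V(1) that]
    by (auto simp: a_def b_def d_def)
  then have "cvderiv (X p) (push (\<lambda>q. N q (Y q) Z)) = cvderiv (X p) (\<lambda>q. d q + a q *s \<sigma> q + b q *s \<nu> q)"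
    by (intro cvderiv_cong[OF Xp push_smooth_near[OF NYZ] _ V(1) p] smooth_near_add sd s\<sigma> s\<nu>)
  also have "\<dots> = cvderiv (X p) d + (a p *s cvderiv (X p) \<sigma> + cderiv (X p) a *s \<sigma> p)
      + (b p *s cvderiv (X p) \<nu> + cderiv (X p) b *s \<nu> p)"
    unfolding cvderiv_add[OF Xp smooth_near_add[OF sd s\<sigma>] s\<nu>] cvderiv_add[OF Xp sd s\<sigma>]
      cvderiv_scale[OF Xp sa sigma_smooth_near] cvderiv_scale[OF Xp sb nu_smooth_near[OF pW]] ..
  finally show ?thesis
    unfolding levi_civita_push[OF NYZ Xp w]
    by (simp add: cbilin_algebra push_sigma[OF w] push_nu[OF pW w] cbilin_commute[of "\<sigma> p"] cbilin_commute[of "\<nu> p"]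
        push_Psi[OF pW Xp] a_def b_def d_def)
qed

text \<open>Antisymmetrising \<open>second_derivative_push\<close> in \<open>X\<close> and \<open>Y\<close> cancels the flat second derivatives against the
  bracket term.\<close>

lemma gauss:
  assumes V: "open V" "V \<subseteq> W" and X: "vector_field_on A V X" and Y: "vector_field_on A V Y"
    and Z: "vector_field_on A V Z" and p: "p \<in> V" and w: "w \<in> ctangent_space A p"
  shows "induced_metric \<sigma> p (curvature A N X Y Z p) w =
    - (induced_metric \<sigma> p (Y p) (Z p) * induced_metric \<sigma> p (X p) w - induced_metric \<sigma> p (X p) (Z p) * induced_metric \<sigma> p (Y p) w)
    + (induced_metric \<sigma> p (\<Psi> p (Y p)) (Z p) * induced_metric \<sigma> p (\<Psi> p (X p)) w
      - induced_metric \<sigma> p (\<Psi> p (X p)) (Z p) * induced_metric \<sigma> p (\<Psi> p (Y p)) w)"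
proof -
  note near = vector_field_on_near[OF _ V(1) p]
  show ?thesis
    unfolding induced_metric_def curvature_def cvderiv_diff cbilin_diff_left
      second_derivative_push[OF V X Y Z p w] second_derivative_push[OF V Y X Z p w]
      levi_civita_push[OF near[OF Z] lie_bracket_tangent[OF near[OF X] near[OF Y]] w]
      cvderiv_lie_bracket[OF near[OF X] near[OF Y] push_smooth_near[OF near[OF Z]]]
    by (simp add: algebra_simps)
qed

lemma linear_functional_sum:
  assumes lin: "\<And>u v a b. u \<in> ctangent_space A p \<Longrightarrow> v \<in> ctangent_space A p \<Longrightarrow>
      \<alpha> (\<lambda>f. a * u f + b * v f) = a * \<alpha> u + b * \<alpha> v"
    and E: "\<And>i. i \<in> I \<Longrightarrow> E i \<in> ctangent_space A p"
  shows "\<alpha> (\<lambda>f. \<Sum>i\<in>I. c i * E i f) = (\<Sum>i\<in>I. c i * \<alpha> (E i))"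
proof -
  have zero: "\<alpha> (\<lambda>_. 0) = 0" using lin[OF zero_ctangent zero_ctangent, of 0 0] by simp
  show ?thesis using E
  proof (induction I rule: infinite_finite_induct)
    case (insert i I)
    then show ?case
      using lin[of "E i" "\<lambda>f. \<Sum>i\<in>I. c i * E i f" "c i" 1] ctangent_sum[of I E p c] by simp
  qed (simp_all add: zero)
qed

lemma metric_frame_component:
  assumes orth: "\<And>j. induced_metric \<sigma> p (E j) (E i) = (if j = i then 1 else 0)"
  shows "induced_metric \<sigma> p (\<lambda>f. \<Sum>j\<in>UNIV. c j * E j f) (E (i::'n)) = c i"
proof -
  have "induced_metric \<sigma> p (\<lambda>f. \<Sum>j\<in>UNIV. c j * E j f) (E i) = (\<Sum>j\<in>UNIV. c j * induced_metric \<sigma> p (E j) (E i))"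
    unfolding induced_metric_def cvderiv_sum by (simp add: cbilin_def sum_distrib_left sum_distrib_right mult.assoc) (rule sum.swap)
  then show ?thesis unfolding orth by (simp add: if_distrib cong: if_cong)
qed

text \<open>In an orthonormal frame \<open>\<theta>\<^sup>i\<close> is the product with \<open>X\<^sub>i\<close>, and by symmetry of \<open>\<Psi>\<close> the form \<open>\<Psi>\<^sup>i\<close> is the product
  with \<open>\<Psi> X\<^sub>i\<close>; the Gauss equation then takes the stated form.\<close>

lemma gauss_frame:
  assumes U: "open U" and X: "orthonormal_frame_on A (induced_metric \<sigma>) U X"
    and \<theta>: "dual_coframe_on A U X \<theta>"
    and \<Psi>c: "\<And>p v. p \<in> U \<inter> W \<Longrightarrow> v \<in> ctangent_space A p \<Longrightarrow> \<Psi> p v = (\<lambda>f. \<Sum>i\<in>UNIV. \<Psi>c i p v * X i p f)"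
    and V: "open V" "V \<subseteq> U \<inter> W" and Y: "vector_field_on A V Y" and Z: "vector_field_on A V Z" and p: "p \<in> V"
  shows "curvature4 A (induced_metric \<sigma>) N (X i) (X j) Y Z p - wedge (\<Psi>c i) (\<Psi>c j) Y Z p = - wedge (\<theta> i) (\<theta> j) Y Z p"
proof -
  let ?g = "induced_metric \<sigma> p"
  have pU: "p \<in> U" "p \<in> W" "p \<in> U \<inter> W" and VW: "V \<subseteq> W" using V p by auto
  have Xf: "vector_field_on A V (X i)" for i
    using X V by (auto simp: orthonormal_frame_on_def intro: vector_field_on_subset)
  note Xp = vector_field_onD[OF Xf p] and Yp = vector_field_onD[OF Y p] and Zp = vector_field_onD[OF Z p]
  have orth: "?g (X i p) (X j p) = (if i = j then 1 else 0)" for i j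
    using X pU unfolding orthonormal_frame_on_def by blast
  have gsym: "?g u v = ?g v u" for u v by (simp add: induced_metric_def cbilin_commute)
  have th: "?g (X i p) v = \<theta> i p v" if v: "v \<in> ctangent_space A p" for v i
  proof -
    have "\<exists>!c. v = (\<lambda>f. \<Sum>i\<in>UNIV. c i * X i p f)"
      using X pU v unfolding orthonormal_frame_on_def by blast
    then obtain c where c: "v = (\<lambda>f. \<Sum>i\<in>UNIV. c i * X i p f)" by blast
    have "\<theta> i p v = (\<Sum>j\<in>UNIV. c j * \<theta> i p (X j p))"
      unfolding c
    proof (rule linear_functional_sum[OF _ Xp])
      show "\<theta> i p (\<lambda>f. a * u f + b * v f) = a * \<theta> i p u + b * \<theta> i p v"
        if "u \<in> ctangent_space A p" "v \<in> ctangent_space A p" for u v a b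
        using \<theta> pU that unfolding dual_coframe_on_def one_form_on_def by blast
    qed
    also have "\<dots> = (\<Sum>j\<in>UNIV. c j * (if i = j then 1 else 0))"
      using \<theta> pU unfolding dual_coframe_on_def by simp
    also have "\<dots> = c i" by (simp add: if_distrib cong: if_cong)
    finally show ?thesis
      using metric_frame_component[of p "\<lambda>j. X j p" i c] orth gsym[of "X i p" v] by (simp add: c)
  qed
  have ps: "?g (\<Psi> p (X i p)) v = \<Psi>c i p v" if v: "v \<in> ctangent_space A p" for v i
  proof -
    have "?g (\<Psi> p (X i p)) v = ?g (\<Psi> p v) (X i p)"
      using Psi_symmetric[OF pU(2) Xp v] by (simp add: induced_metric_def)
    also have "\<dots> = \<Psi>c i p v"
      unfolding \<Psi>c[OF pU(3) v] by (rule metric_frame_component) (rule orth)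
    finally show ?thesis .
  qed
  show ?thesis
    unfolding curvature4_def gauss[OF V(1) VW Xf Xf Y p Zp] wedge_def
    by (simp add: th ps Yp Zp algebra_simps)
qed

end

theorem theorem3p8:
  fixes A :: "('m::{t2_space, second_countable_topology}, 'n::finite) atlas"
    and \<sigma> :: "'m \<Rightarrow> complex ^ 'k::finite"
    and g :: "'m cmetric"
    and N :: "'m connection"
    and D :: "'k qconnection"
    and B :: "('m, 'k) pconnection"
    and \<nu> :: "'m \<Rightarrow> complex ^ 'k"
    and \<Psi> :: "'m \<Rightarrow> 'm ctvec \<Rightarrow> 'm ctvec"
    and X :: "'n \<Rightarrow> 'm cvfield"
    and \<theta> \<Psi>c :: "'n \<Rightarrow> 'm cform"
    and U W :: "'m set"
  assumes M: "smooth_manifold A"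
    and dim: "CARD('k) = CARD('n) + 2"
    and \<sigma>: "admissible_immersion A \<sigma>"
    and g: "g = induced_metric \<sigma>"
    and N: "levi_civita A g N"
    and D: "quadric_levi_civita D"
    and B: "pullback_connection A \<sigma> D B"
    and W: "open W"
    and \<nu>: "normal_field_on A \<sigma> W \<nu>"
    and \<Psi>: "shape_operator_on A \<sigma> B \<nu> W \<Psi>"
    and U: "open U"
    and X: "orthonormal_frame_on A g U X"
    and \<theta>: "dual_coframe_on A U X \<theta>"
    and \<Psi>c: "\<And>i. one_form_on A (U \<inter> W) (\<Psi>c i)"
      "\<And>p v. p \<in> U \<inter> W \<Longrightarrow> v \<in> ctangent_space A p \<Longrightarrow>
         \<Psi> p v = (\<lambda>f. \<Sum>i\<in>UNIV. \<Psi>c i p v * X i p f)"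
  shows "(\<forall>V Y Z. open V \<longrightarrow> V \<subseteq> W \<longrightarrow> vector_field_on A V Y \<longrightarrow> vector_field_on A V Z \<longrightarrow>
            (\<forall>p\<in>V. d_nabla A N \<Psi> Y Z p = (\<lambda>_. 0))) \<and>
         (\<forall>i j V Y Z. open V \<longrightarrow> V \<subseteq> U \<inter> W \<longrightarrow> vector_field_on A V Y \<longrightarrow> vector_field_on A V Z \<longrightarrow>
            (\<forall>p\<in>V. curvature4 A g N (X i) (X j) Y Z p - wedge (\<Psi>c i) (\<Psi>c j) Y Z p
                    = - wedge (\<theta> i) (\<theta> j) Y Z p))"
proof -
  interpret immersed_hypersurface A \<sigma> D B N \<nu> \<Psi> W
    by unfold_locales (use M \<sigma> D B dim N g W \<nu> \<Psi> in auto)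
  show ?thesis
    unfolding g
    by (intro conjI allI impI ballI codazzi gauss_frame[OF U X[unfolded g] \<theta> \<Psi>c(2)])
qed

end
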